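(* Let $\psi:[0,\infty)\to\mathbb{R}$ be a $C^1$ function with $\psi'>0$, $\psi(0)=0$ and $\psi(x)\to\infty$ as $x\to\infty$, and let $\omega\in L^\infty(\mathbb{R}^+)$ be a nowhere zero differentiable weight function. Let $\alpha,p\in\mathbb{C}$ with $\Re(\alpha)>0$, put $n=[\Re(\alpha)]+1$ (where $[\cdot]$ denotes the integer part), and assume $\Re(p)<1+\Re(\alpha)$. Let $f:\mathbb{R}^+\to\mathbb{C}$ be such that the function $x\mapsto\psi(x)^{p-\alpha-1}f(x)$ belongs to $L^1_{\omega,\psi}(\mathbb{R}^+)$, such that the derivative ${}^{RL}D^{\alpha}_{\psi,\omega}f$ exists on $\mathbb{R}^+$, and such that the integral defining $\mathcal{M}_{\psi,\omega}\big[{}^{RL}D^{\alpha}_{\psi,\omega}f\big](p)$ converges absolutely. Suppose that for $k=0,1,\dots,n-1$ $$\lim_{x\to0^+}\psi(x)^{p-k-1}\big({}^{RL}_{\ 0}I^{n-\alpha}_{\psi,\omega}f\big)(x)=0\quad\text{and}\quad\lim_{x\to\infty}\psi(x)^{p-k-1}\big({}^{RL}_{\ 0}I^{n-\alpha}_{\psi,\omega}f\big)(x)=0.$$ Then $$\mathcal{M}_{\psi,\omega}\big[{}^{RL}D^{\alpha}_{\psi,\omega}f\big](p)=\frac{\Gamma(1-p+\alpha)}{\Gamma(1-p)}\,\mathcal{M}_{\psi,\omega}[f](p-\alpha).$$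
   Context: Here $\mathbb{R}^+=(0,\infty)$. The space $L^1_{\omega,\psi}(\mathbb{R}^+)$ consists of the measurable functions $f:\mathbb{R}^+\to\mathbb{C}$ with $\int_0^\infty|\omega(x)f(x)|\,\psi'(x)\,dx<\infty$. The generalized ($\psi$-$\omega$-) Mellin transform is $$\mathcal{M}_{\psi,\omega}[f](p)=\int_0^\infty(\psi(x))^{p-1}\omega(x)f(x)\psi'(x)\,dx,$$ for those $p\in\mathbb{C}$ for which the integral converges. The $\omega$-weighted Riemann-Liouville fractional integral with respect to $\psi$ of order $\beta$, $\Re(\beta)>0$, is $${}^{RL}_{\ 0}I^{\beta}_{\psi,\omega}f(x)=\frac{1}{\Gamma(\beta)\,\omega(x)}\int_0^x(\psi(x)-\psi(t))^{\beta-1}\omega(t)f(t)\psi'(t)\,dt,\qquad x>0.$$ The weighted derivative with respect to $\psi$ is $$\mathcal{D}_{\psi,\omega}h(x)=\frac{1}{\omega(x)\psi'(x)}\frac{d}{dx}\big(\omega(x)h(x)\big),$$ and $\mathcal{D}^k_{\psi,\omega}$ is its $k$-fold iterate. For $n=[\Re(\alpha)]+1$, the weighted Riemann-Liouville fractional derivative with respect to $\psi$ (based at $0$) is $${}^{RL}D^{\alpha}_{\psi,\omega}f=\mathcal{D}^n_{\psi,\omega}\big({}^{RL}_{\ 0}I^{n-\alpha}_{\psi,\omega}f\big).$$ That it exists means that, for $h={}^{RL}_{\ 0}I^{n-\alpha}_{\psi,\omega}f$, the functions $\mathcal{D}^k_{\psi,\omega}h$ exist on $\mathbb{R}^+$ for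 $k=1,\dots,n$, with $\mathcal{D}^n_{\psi,\omega}h$ continuous or locally integrable with respect to $\psi'(x)\,dx$. *)

theory Defs
  imports "HOL-Analysis.Analysis"
begin

text \<open>
  Functions on the open half-line \<open>(0, \<infinity>)\<close> are represented by total functions on \<open>real\<close>; all
  notions below depend only on the values at positive arguments. The weight \<open>\<omega>\<close> is allowed to be
  complex-valued, real weights being a special case.
\<close>

definition Linfty_pos :: "(real \<Rightarrow> complex) set" where
  "Linfty_pos = {g. g \<in> borel_measurable (lebesgue_on {0<..}) \<and>
     (\<exists>C. AE x in lebesgue_on {0<..}. cmod (g x) \<le> C)}"

definition L1_weighted :: "(real \<Rightarrow> real) \<Rightarrow> (real \<Rightarrow> complex) \<Rightarrow> (real \<Rightarrow> complex) set" where
  "L1_weighted \<psi> \<omega> = {f. f \<in> borel_measurable (lebesgue_on {0<..}) \<and>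
     integrable (lebesgue_on {0<..}) (\<lambda>x. cmod (\<omega> x * f x) * deriv \<psi> x)}"

definition mellin_integrand ::
    "(real \<Rightarrow> real) \<Rightarrow> (real \<Rightarrow> complex) \<Rightarrow> (real \<Rightarrow> complex) \<Rightarrow> complex \<Rightarrow> real \<Rightarrow> complex" where
  "mellin_integrand \<psi> \<omega> f p x =
     of_real (\<psi> x) powr (p - 1) * \<omega> x * f x * of_real (deriv \<psi> x)"

definition mellin_abs_convergent ::
    "(real \<Rightarrow> real) \<Rightarrow> (real \<Rightarrow> complex) \<Rightarrow> (real \<Rightarrow> complex) \<Rightarrow> complex \<Rightarrow> bool" where
  "mellin_abs_convergent \<psi> \<omega> f p \<longleftrightarrow>
     set_integrable lebesgue {0<..} (mellin_integrand \<psi> \<omega> f p)"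

text \<open>
  A Lebesgue integral: it has its intended value only where the integral converges absolutely.
\<close>

definition mellin ::
    "(real \<Rightarrow> real) \<Rightarrow> (real \<Rightarrow> complex) \<Rightarrow> (real \<Rightarrow> complex) \<Rightarrow> complex \<Rightarrow> complex" where
  "mellin \<psi> \<omega> f p = (LINT x:{0<..}|lebesgue. mellin_integrand \<psi> \<omega> f p x)"

definition RL_integrand ::
    "(real \<Rightarrow> real) \<Rightarrow> (real \<Rightarrow> complex) \<Rightarrow> complex \<Rightarrow> (real \<Rightarrow> complex) \<Rightarrow> real \<Rightarrow> real \<Rightarrow> complex" where
  "RL_integrand \<psi> \<omega> \<beta> f x t =
     of_real (\<psi> x - \<psi> t) powr (\<beta> - 1) * \<omega> t * f t * of_real (deriv \<psi> t)"

definition RL_integral_exists ::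
    "(real \<Rightarrow> real) \<Rightarrow> (real \<Rightarrow> complex) \<Rightarrow> complex \<Rightarrow> (real \<Rightarrow> complex) \<Rightarrow> bool" where
  "RL_integral_exists \<psi> \<omega> \<beta> f \<longleftrightarrow>
     (\<forall>x>0. set_integrable lebesgue {0<..<x} (RL_integrand \<psi> \<omega> \<beta> f x))"

definition RL_integral ::
    "(real \<Rightarrow> real) \<Rightarrow> (real \<Rightarrow> complex) \<Rightarrow> complex \<Rightarrow> (real \<Rightarrow> complex) \<Rightarrow> real \<Rightarrow> complex" where
  "RL_integral \<psi> \<omega> \<beta> f x =
     1 / (Gamma \<beta> * \<omega> x) * (LINT t:{0<..<x}|lebesgue. RL_integrand \<psi> \<omega> \<beta> f x t)"

definition weighted_deriv ::
    "(real \<Rightarrow> real) \<Rightarrow> (real \<Rightarrow> complex) \<Rightarrow> (real \<Rightarrow> complex) \<Rightarrow> real \<Rightarrow> complex" where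
  "weighted_deriv \<psi> \<omega> h x =
     1 / (\<omega> x * of_real (deriv \<psi> x)) * vector_derivative (\<lambda>t. \<omega> t * h t) (at x)"

definition RL_order :: "complex \<Rightarrow> nat" where
  "RL_order \<alpha> = nat \<lfloor>Re \<alpha>\<rfloor> + 1"

definition RL_derivative ::
    "(real \<Rightarrow> real) \<Rightarrow> (real \<Rightarrow> complex) \<Rightarrow> complex \<Rightarrow> (real \<Rightarrow> complex) \<Rightarrow> real \<Rightarrow> complex" where
  "RL_derivative \<psi> \<omega> \<alpha> f =
     (weighted_deriv \<psi> \<omega> ^^ RL_order \<alpha>) (RL_integral \<psi> \<omega> (of_nat (RL_order \<alpha>) - \<alpha>) f)"

definition locally_integrable_wrt :: "(real \<Rightarrow> real) \<Rightarrow> (real \<Rightarrow> complex) \<Rightarrow> bool" where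
  "locally_integrable_wrt \<psi> g \<longleftrightarrow>
     (\<forall>K. compact K \<and> K \<subseteq> {0<..} \<longrightarrow> set_integrable lebesgue K (\<lambda>x. g x * of_real (deriv \<psi> x)))"

text \<open>
  The iterate of order \<open>k + 1\<close> exists on the half-line iff \<open>\<omega>\<close> times the iterate of order \<open>k\<close> is
  differentiable there. Since \<open>LINT\<close> and \<open>vector_derivative\<close> are total, existence of the underlying
  fractional integral at every point has to be required as well.
\<close>

definition RL_derivative_exists ::
    "(real \<Rightarrow> real) \<Rightarrow> (real \<Rightarrow> complex) \<Rightarrow> complex \<Rightarrow> (real \<Rightarrow> complex) \<Rightarrow> bool" where
  "RL_derivative_exists \<psi> \<omega> \<alpha> f \<longleftrightarrow>
     (let n = RL_order \<alpha>; h = RL_integral \<psi> \<omega> (of_nat n - \<alpha>) f in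
        RL_integral_exists \<psi> \<omega> (of_nat n - \<alpha>) f \<and>
        (\<forall>k<n. \<forall>x>0. (\<lambda>t. \<omega> t * (weighted_deriv \<psi> \<omega> ^^ k) h t) differentiable (at x)) \<and>
        (continuous_on {0<..} ((weighted_deriv \<psi> \<omega> ^^ n) h) \<or>
         locally_integrable_wrt \<psi> ((weighted_deriv \<psi> \<omega> ^^ n) h)))"

text \<open>
  A quotient \<open>Gamma a / Gamma b\<close> of complex Gamma values agrees with \<open>Gamma a * rGamma b\<close> also at the
  poles of \<open>Gamma b\<close>: there \<open>Gamma b = 0\<close> in the library, so the quotient is 0, as in the usual
  convention that the reciprocal Gamma function vanishes at the poles.
\<close>

end

theory Submission
  imports Defs "HOL-Complex_Analysis.Cauchy_Integral_Theorem"
begin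

text \<open>
  Substituting \<open>u = \<psi> x\<close> reduces everything to the classical case. There \<open>F = \<omega> f\<close>, and \<open>z\<^sub>k = \<omega> D\<^sup>k h\<close> satisfies
  \<open>z\<^sub>k' = z\<^bsub>k+1\<^esub>\<close>, where \<open>z\<^sub>0\<close> is the fractional integral of \<open>F\<close>. By Fubini and the Gamma integral,
  \<open>\<integral> u\<^bsup>p-1-n\<^esup> z\<^sub>0 du = \<Gamma>(1-p+\<alpha>) / \<Gamma>(1-p+n) \<integral> s\<^bsup>p-\<alpha>-1\<^esup> F ds\<close>, and \<open>n\<close> integrations by parts contribute
  the factor \<open>(1-p)\<^sub>n = \<Gamma>(1-p+n) / \<Gamma>(1-p)\<close>.

  The boundary terms \<open>u\<^bsup>p-n+j\<^esup> z\<^sub>j\<close> with \<open>0 < j < n\<close> are not covered by the hypotheses, which only bound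
  \<open>z\<^sub>0\<close>. They vanish by a Landau-Kolmogorov type interpolation on the dyadic intervals \<open>[u, 2u]\<close> between
  \<open>u\<^bsup>p-n\<^esup> z\<^sub>0 \<longrightarrow> 0\<close> and the integrability of \<open>u\<^bsup>p-1\<^esup> z\<^sub>n\<close>.
\<close>

section \<open>Gamma integrals\<close>

text \<open>Euler's integral after the substitution of \<open>s * t\<close> for \<open>t\<close>.
  Read backwards it writes \<open>of_real s powr (- z)\<close> as a Laplace integral, which is how
  the Beta integral is obtained further on.\<close>

lemma Gamma_integral_scaled:
  assumes z: "Re z > 0" and s: "s > 0"
  shows "(\<lambda>t. of_real t powr (z - 1) * of_real (exp (- (s * t)))) absolutely_integrable_on {0<..}"
    and "integral {0<..} (\<lambda>t. of_real t powr (z - 1) * of_real (exp (- (s * t)))) = Gamma z / of_real s powr z"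
proof -
  let ?f = "\<lambda>t. complex_of_real t powr (z - 1) / of_real (exp t)"
  let ?g = "\<lambda>t. complex_of_real t powr (z - 1) * of_real (exp (- (s * t)))"
  have img: "(\<lambda>t. s * t) ` {0<..} = {0<..}"
    using s by (auto simp: image_iff intro!: bexI[of _ "_ / s"])
  have "?f absolutely_integrable_on (\<lambda>t. s * t) ` {0<..} \<and> integral ((\<lambda>t. s * t) ` {0<..}) ?f = Gamma z"
    unfolding img using absolutely_integrable_Gamma_integral'[OF z] Gamma_integral_complex'[OF z]
    by (auto simp: integral_unique)
  then have *: "(\<lambda>t. \<bar>s\<bar> *\<^sub>R ?f (s * t)) absolutely_integrable_on {0<..} \<and>
      integral {0<..} (\<lambda>t. \<bar>s\<bar> *\<^sub>R ?f (s * t)) = Gamma z"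
    by (subst has_absolute_integral_change_of_variables_real) (use s in \<open>auto intro!: derivative_eq_intros inj_onI\<close>)
  have eq: "\<bar>s\<bar> *\<^sub>R ?f (s * t) = of_real s powr z * ?g t" if "t \<in> {0<..}" for t
  proof -
    have "complex_of_real (s * t) powr (z - 1) = of_real s powr (z - 1) * of_real t powr (z - 1)"
      using s that by (simp add: powr_times_real)
    moreover have "of_real s powr z = of_real s * complex_of_real s powr (z - 1)"
      using s by (simp add: powr_diff)
    ultimately show ?thesis using s by (simp add: scaleR_conv_of_real exp_minus field_simps)
  qed
  have ai: "?g absolutely_integrable_on {0<..} \<longleftrightarrow> (\<lambda>t. of_real s powr z * ?g t) absolutely_integrable_on {0<..}"
    using s by (subst set_integrable_mult_right_iff) auto
  have "(\<lambda>t. of_real s powr z * ?g t) absolutely_integrable_on {0<..}"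
    using * eq by (metis (no_types, lifting) set_integrable_cong)
  then show "?g absolutely_integrable_on {0<..}" using ai by blast
  have "integral {0<..} (\<lambda>t. of_real s powr z * ?g t) = Gamma z"
    using * eq by (metis (no_types, lifting) integral_cong)
  then show "integral {0<..} ?g = Gamma z / of_real s powr z"
    using s by (simp add: field_simps)
qed

section \<open>Fubini for absolutely integrable functions\<close>

text \<open>Completion does not change the measure of Borel sets, so a countable cover of
  \<open>lborel\<close> by sets of finite measure still serves. Fubini's theorem for
  \<open>lebesgue_on\<close> rests on this.\<close>

lemma sigma_finite_lebesgue: "sigma_finite_measure (lebesgue :: 'a :: euclidean_space measure)"
proof (rule sigma_finite_measure.intro)
  from sigma_finite_measure.sigma_finite_countable[OF sigma_finite_lborel]
  obtain A :: "'a set set" where A: "countable A" "A \<subseteq> sets lborel" "\<Union>A = space lborel"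
      "\<forall>a\<in>A. emeasure lborel a \<noteq> \<infinity>"
    by (elim exE conjE) (rule that)
  have "A \<subseteq> sets lebesgue"
    by (rule subset_trans[OF A(2)]) (rule subsetI, rule sets_completionI_sets)
  moreover have "\<forall>a\<in>A. emeasure lebesgue a \<noteq> \<infinity>"
  proof
    fix a assume "a \<in> A"
    then have "a \<in> sets lborel" "emeasure lborel a \<noteq> \<infinity>" using A(2,4) by blast+
    then show "emeasure lebesgue a \<noteq> \<infinity>" by (simp add: emeasure_completion[OF sets_completionI_sets]) 
  qed
  moreover have "\<Union>A = space lebesgue" unfolding A(3) by (rule space_completion[symmetric])
  ultimately show "\<exists>A. countable A \<and> A \<subseteq> sets lebesgue \<and> \<Union> A = space (lebesgue :: 'a measure) \<and> (\<forall>a\<in>A. emeasure lebesgue a \<noteq> \<infinity>)"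
    using A(1) by (intro exI[of _ A] conjI)
qed

lemma integrable_lebesgue_on_eq:
  fixes f :: "real \<Rightarrow> 'a :: euclidean_space"
  assumes "S \<in> sets lebesgue"
  shows "integrable (lebesgue_on S) f \<longleftrightarrow> f absolutely_integrable_on S"
    and "f absolutely_integrable_on S \<Longrightarrow> integral\<^sup>L (lebesgue_on S) f = integral S f"
proof -
  show "integrable (lebesgue_on S) f \<longleftrightarrow> f absolutely_integrable_on S"
    using assms by (simp add: integrable_restrict_space set_integrable_def)
  assume "f absolutely_integrable_on S"
  from set_lebesgue_integral_eq_integral(2)[OF this]
  show "integral\<^sup>L (lebesgue_on S) f = integral S f"
    using assms by (simp add: integral_restrict_space set_lebesgue_integral_def)
qed

text \<open>Measurability refers to the product of two Lebesgue sigma-algebras because the function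
  in the fractional integral will be Lebesgue measurable only. \<open>inner\<close> and
  \<open>outer\<close> hold at every point, not just almost everywhere, so that gauge integrals can
  replace Bochner integrals pointwise.\<close>

lemma Fubini_absolutely_integrable:
  fixes K :: "real \<Rightarrow> real \<Rightarrow> 'a :: euclidean_space"
  assumes S: "S \<in> sets lebesgue" and T: "T \<in> sets lebesgue"
    and meas: "(\<lambda>(x, y). K x y) \<in> borel_measurable (lebesgue_on S \<Otimes>\<^sub>M lebesgue_on T)"
    and inner: "\<And>x. x \<in> S \<Longrightarrow> K x absolutely_integrable_on T"
    and outer: "\<And>y. y \<in> T \<Longrightarrow> (\<lambda>x. K x y) absolutely_integrable_on S"
    and norm: "(\<lambda>x. integral T (\<lambda>y. norm (K x y))) absolutely_integrable_on S"
  shows "(\<lambda>y. integral S (\<lambda>x. K x y)) absolutely_integrable_on T"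
    and "integral T (\<lambda>y. integral S (\<lambda>x. K x y)) = integral S (\<lambda>x. integral T (K x))"
proof -
  interpret pair_sigma_finite "lebesgue_on S" "lebesgue_on T"
    by (intro pair_sigma_finite.intro sigma_finite_measure_restrict_space sigma_finite_lebesgue S T)
  note SS = integrable_lebesgue_on_eq[OF S] and TT = integrable_lebesgue_on_eq[OF T]
  have norm_inner: "(\<lambda>y. norm (K x y)) absolutely_integrable_on T" if "x \<in> S" for x
    using inner[OF that] by (rule set_integrable_norm)
  have iS: "(\<integral>x. K x y \<partial>lebesgue_on S) = integral S (\<lambda>x. K x y)" if "y \<in> T" for y
    using outer[OF that] by (rule SS(2))
  have iT: "(\<integral>y. K x y \<partial>lebesgue_on T) = integral T (K x)" if "x \<in> S" for x
    using inner[OF that] by (rule TT(2))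
  have iN: "(\<integral>y. norm (K x y) \<partial>lebesgue_on T) = integral T (\<lambda>y. norm (K x y))" if "x \<in> S" for x
    using norm_inner[OF that] by (rule TT(2))
  have "integrable (lebesgue_on S) (\<lambda>x. \<integral>y. norm (K x y) \<partial>lebesgue_on T) \<longleftrightarrow>
      integrable (lebesgue_on S) (\<lambda>x. integral T (\<lambda>y. norm (K x y)))"
    by (rule Bochner_Integration.integrable_cong) (simp_all add: iN)
  then have n: "integrable (lebesgue_on S) (\<lambda>x. \<integral>y. norm (K x y) \<partial>lebesgue_on T)"
    using norm by (simp add: SS(1))
  have "AE x in lebesgue_on S. integrable (lebesgue_on T) (K x)"
    by (rule AE_I2) (simp add: TT(1) inner)
  then have I: "integrable (lebesgue_on S \<Otimes>\<^sub>M lebesgue_on T) (\<lambda>(x, y). K x y)"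
    using n by (intro Fubini_integrable meas) simp_all
  have "integrable (lebesgue_on T) (\<lambda>y. \<integral>x. K x y \<partial>lebesgue_on S) \<longleftrightarrow>
      integrable (lebesgue_on T) (\<lambda>y. integral S (\<lambda>x. K x y))"
    by (rule Bochner_Integration.integrable_cong) (simp_all add: iS)
  with integrable_snd[OF I] show ai: "(\<lambda>y. integral S (\<lambda>x. K x y)) absolutely_integrable_on T"
    by (simp add: TT(1))
  have "integrable (lebesgue_on S) (\<lambda>x. \<integral>y. K x y \<partial>lebesgue_on T) \<longleftrightarrow>
      integrable (lebesgue_on S) (\<lambda>x. integral T (K x))"
    by (rule Bochner_Integration.integrable_cong) (simp_all add: iT)
  with integrable_fst[OF I] have ai2: "(\<lambda>x. integral T (K x)) absolutely_integrable_on S"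
    by (simp add: SS(1))
  have "integral T (\<lambda>y. integral S (\<lambda>x. K x y)) = (\<integral>y. integral S (\<lambda>x. K x y) \<partial>lebesgue_on T)"
    by (rule TT(2)[OF ai, symmetric])
  also have "\<dots> = (\<integral>y. (\<integral>x. K x y \<partial>lebesgue_on S) \<partial>lebesgue_on T)"
    by (intro Bochner_Integration.integral_cong refl) (simp add: iS)
  also have "\<dots> = (\<integral>x. (\<integral>y. K x y \<partial>lebesgue_on T) \<partial>lebesgue_on S)"
    by (rule Fubini_integral[OF I])
  also have "\<dots> = (\<integral>x. integral T (K x) \<partial>lebesgue_on S)"
    by (intro Bochner_Integration.integral_cong refl) (simp add: iT)
  also have "\<dots> = integral S (\<lambda>x. integral T (K x))"
    by (rule SS(2)[OF ai2])
  finally show "integral T (\<lambda>y. integral S (\<lambda>x. K x y)) = integral S (\<lambda>x. integral T (K x))" .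
qed

text \<open>A Beta integral. Up to the factor \<open>Gamma c\<close>, the power
  \<open>of_real (v + w) powr (- c)\<close> is the Laplace integral of
  \<open>of_real s powr (c - 1)\<close>; exchanging the integrations over \<open>s\<close> and
  \<open>w\<close> leaves two Gamma integrals.\<close>

lemma absolutely_integrable_Mellin_shift:
  assumes v: "v > 0" and b: "Re b > 0" and c: "Re b < Re c"
  shows "(\<lambda>w. of_real (v + w) powr (- c) * of_real w powr (b - 1)) absolutely_integrable_on {0<..}" (is ?A)
    and "integral {0<..} (\<lambda>w. of_real (v + w) powr (- c) * of_real w powr (b - 1)) =
      Gamma b * Gamma (c - b) / Gamma c * of_real v powr (b - c)" (is ?B)
proof -
  \<comment> \<open>\<open>b\<close> and \<open>c\<close> are arguments because \<open>K\<close> is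
    also evaluated at their real parts.\<close>
  define K :: "complex \<Rightarrow> complex \<Rightarrow> real \<Rightarrow> real \<Rightarrow> complex" where
    "K b c s w = of_real s powr (c - 1) * of_real (exp (- ((v + w) * s))) * of_real w powr (b - 1)" for b c s w
  have Gc: "Gamma c \<noteq> 0"
    using b c by (auto simp: Gamma_eq_zero_iff elim!: nonpos_Ints_cases)
  have in_w: "K b c s absolutely_integrable_on {0<..}"
     "integral {0<..} (K b c s) = Gamma b * (of_real s powr (c - b - 1) * of_real (exp (- (v * s))))"
    if s: "s > 0" and b: "Re b > 0" for b c s
  proof -
    have eq: "K b c s = (\<lambda>w. (of_real s powr (c - 1) * of_real (exp (- (v * s)))) *
        (of_real w powr (b - 1) * of_real (exp (- (s * w)))))"
    proof
      fix w
      have "exp (- ((v + w) * s)) = exp (- (v * s)) * exp (- (s * w))"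
        by (simp add: exp_add[symmetric] algebra_simps)
      then show "K b c s w = (of_real s powr (c - 1) * of_real (exp (- (v * s)))) *
        (of_real w powr (b - 1) * of_real (exp (- (s * w))))" by (simp add: K_def)
    qed
    show "K b c s absolutely_integrable_on {0<..}"
      unfolding eq by (intro set_integrable_mult_right Gamma_integral_scaled b s)
    have "integral {0<..} (K b c s) = of_real s powr (c - 1) * of_real (exp (- (v * s))) * (Gamma b / of_real s powr b)"
      unfolding eq by (simp add: Gamma_integral_scaled b s)
    also have "complex_of_real s powr (c - b - 1) = of_real s powr (c - 1) / of_real s powr b"
      by (simp add: powr_diff[symmetric] algebra_simps)
    ultimately show "integral {0<..} (K b c s) = Gamma b * (of_real s powr (c - b - 1) * of_real (exp (- (v * s))))"
      by simp
  qed
  have in_s: "(\<lambda>s. K b c s w) absolutely_integrable_on {0<..}"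
     "integral {0<..} (\<lambda>s. K b c s w) = Gamma c * (of_real (v + w) powr (- c) * of_real w powr (b - 1))"
    if w: "w > 0" for w
  proof -
    have eq: "(\<lambda>s. K b c s w) = (\<lambda>s. (of_real s powr (c - 1) * of_real (exp (- ((v + w) * s)))) * of_real w powr (b - 1))"
      by (simp add: K_def fun_eq_iff)
    have c0: "Re c > 0" "v + w > 0" using b c v w by auto
    show "(\<lambda>s. K b c s w) absolutely_integrable_on {0<..}"
      unfolding eq by (intro set_integrable_mult_left Gamma_integral_scaled c0)
    show "integral {0<..} (\<lambda>s. K b c s w) = Gamma c * (of_real (v + w) powr (- c) * of_real w powr (b - 1))"
      unfolding eq integral_mult_left Gamma_integral_scaled(2)[OF c0] by (simp add: powr_minus divide_inverse)
  qed
  have norm_K: "complex_of_real (norm (K b c s w)) = K (of_real (Re b)) (of_real (Re c)) s w" if "s > 0" "w > 0" for s w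
  proof -
    have "norm (complex_of_real x powr a) = x powr Re a" if "x > 0" for x a
      using that by (simp add: norm_powr_real_powr)
    moreover have "complex_of_real (x powr a) = complex_of_real x powr complex_of_real a" if "x > 0" for x a
      using that by (simp add: powr_of_real)
    ultimately show ?thesis using that by (simp add: K_def norm_mult)
  qed
  have gam: "(\<lambda>s. Gamma b * (of_real s powr (c - b - 1) * of_real (exp (- (v * s))))) absolutely_integrable_on {0<..}"
    if "Re b < Re c" for b c
    using that v by (intro set_integrable_mult_right Gamma_integral_scaled) auto
  \<comment> \<open>The norm of \<open>K\<close> is \<open>K\<close> at the real parts of the
    exponents, so \<open>in_w\<close> evaluates its inner integral as well, and \<open>gam\<close>
    makes the result integrable. The norms are embedded into the complex numbers for this;
    \<open>Re\<close> leads back.\<close>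
  have "(\<lambda>s. complex_of_real (integral {0<..} (\<lambda>w. norm (K b c s w)))) absolutely_integrable_on {0<..}"
  proof (subst set_integrable_cong[OF refl refl])
    fix s :: real assume "s \<in> {0<..}"
    then have s: "s > 0" by simp
    have "(\<lambda>w. norm (K b c s w)) integrable_on {0<..}"
      using in_w(1)[OF s b] absolutely_integrable_on_def by blast
    then have "complex_of_real (integral {0<..} (\<lambda>w. norm (K b c s w))) = integral {0<..} (\<lambda>w. complex_of_real (norm (K b c s w)))"
      by (rule integral_linear[OF _ bounded_linear_of_real, unfolded o_def, symmetric])
    also have "\<dots> = integral {0<..} (K (of_real (Re b)) (of_real (Re c)) s)"
      using s by (intro integral_cong) (simp add: norm_K)
    finally show "complex_of_real (integral {0<..} (\<lambda>w. norm (K b c s w))) =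
       Gamma (of_real (Re b)) * (of_real s powr (of_real (Re c) - of_real (Re b) - 1) * of_real (exp (- (v * s))))"
      using in_w(2)[of s "of_real (Re b)" "of_real (Re c)"] b s by simp
  qed (use gam[of "of_real (Re b)" "of_real (Re c)"] c in simp)
  from absolutely_integrable_linear[OF this bounded_linear_Re]
  have norm: "(\<lambda>s. integral {0<..} (\<lambda>w. norm (K b c s w))) absolutely_integrable_on {0<..}"
    by (simp add: o_def)
  have meas: "(\<lambda>(s, w). K b c s w) \<in> borel_measurable (lebesgue_on {0<..} \<Otimes>\<^sub>M lebesgue_on {0<..})"
  proof -
    have [measurable]: "(\<lambda>x::real. x) \<in> borel_measurable (lebesgue_on {0<..})"
      by (intro continuous_imp_measurable_on_sets_lebesgue continuous_intros) auto
    show ?thesis unfolding K_def by measurable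
  qed
  have F: "(\<lambda>w. integral {0<..} (\<lambda>s. K b c s w)) absolutely_integrable_on {0<..}"
     "integral {0<..} (\<lambda>w. integral {0<..} (\<lambda>s. K b c s w)) = integral {0<..} (\<lambda>s. integral {0<..} (K b c s))"
    by (rule Fubini_absolutely_integrable[OF _ _ meas _ _ norm]; simp add: in_w(1)[OF _ b] in_s(1))+
  have "(\<lambda>w. Gamma c * (of_real (v + w) powr (- c) * of_real w powr (b - 1))) absolutely_integrable_on {0<..}"
    using F(1) by (subst set_integrable_cong[OF refl refl in_s(2)[symmetric]]) auto
  then show ?A using Gc by (subst (asm) set_integrable_mult_right_iff) auto
  have "Gamma c * integral {0<..} (\<lambda>w. of_real (v + w) powr (- c) * of_real w powr (b - 1)) =
     integral {0<..} (\<lambda>w. integral {0<..} (\<lambda>s. K b c s w))"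
    by (subst integral_mult_right[symmetric], rule integral_cong) (simp add: in_s)
  also have "\<dots> = integral {0<..} (\<lambda>s. Gamma b * (of_real s powr (c - b - 1) * of_real (exp (- (v * s)))))"
    unfolding F(2) using b by (intro integral_cong) (simp add: in_w)
  also have "\<dots> = Gamma b * (Gamma (c - b) / of_real v powr (c - b))"
    using v c by (simp add: Gamma_integral_scaled)
  finally have "integral {0<..} (\<lambda>w. of_real (v + w) powr (- c) * of_real w powr (b - 1)) =
      Gamma b * (Gamma (c - b) / of_real v powr (c - b)) / Gamma c"
    using Gc by (metis nonzero_mult_div_cancel_left)
  moreover have "complex_of_real v powr (b - c) = 1 / of_real v powr (c - b)"
    using powr_minus[of "complex_of_real v" "c - b"] by (simp add: field_simps)
  ultimately show ?B by simp
qed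

section \<open>The Mellin transform of a fractional integral\<close>

lemma absolutely_integrable_restrict_iff:
  fixes f :: "real \<Rightarrow> 'a :: euclidean_space"
  assumes "S \<subseteq> T"
  shows "(\<lambda>x. if x \<in> S then f x else 0) absolutely_integrable_on T \<longleftrightarrow> f absolutely_integrable_on S"
proof -
  have "(\<lambda>x. indicator T x *\<^sub>R (if x \<in> S then f x else 0)) = (\<lambda>x. indicator S x *\<^sub>R f x)"
    using assms by (auto simp: fun_eq_iff indicator_def)
  then show ?thesis by (simp only: set_integrable_def)
qed

lemma integral_restrict_subset:
  fixes f :: "real \<Rightarrow> 'a :: banach"
  assumes "S \<subseteq> T"
  shows "integral T (\<lambda>x. if x \<in> S then f x else 0) = integral S f"
  by (simp add: integral_def integrable_on_def has_integral_restrict[OF assms])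

text \<open>The shift \<open>u = s + w\<close> turns the Beta integral into the Mellin integral of
  the fractional kernel in its upper limit \<open>u\<close>. Extension by 0 below \<open>s\<close>
  lets Fubini's theorem work on a full quadrant instead of a triangle.\<close>

lemma Mellin_kernel:
  assumes s: "s > 0" and b: "Re b > 0" and c: "Re b < Re c"
  shows "(\<lambda>u. if s < u then of_real u powr (- c) * of_real (u - s) powr (b - 1) else 0) absolutely_integrable_on {0<..}"
    and "integral {0<..} (\<lambda>u. if s < u then of_real u powr (- c) * of_real (u - s) powr (b - 1) else 0) =
      Gamma b * Gamma (c - b) / Gamma c * of_real s powr (b - c)"
proof -
  let ?f = "\<lambda>u. of_real u powr (- c) * of_real (u - s) powr (b - 1)"
  have img: "(\<lambda>w. s + w) ` {0<..} = {s<..}"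
    by (auto simp: image_iff intro!: bexI[of _ "_ - s"])
  have "(\<lambda>w. \<bar>1\<bar> *\<^sub>R ?f (s + w)) absolutely_integrable_on {0<..} \<and>
      integral {0<..} (\<lambda>w. \<bar>1\<bar> *\<^sub>R ?f (s + w)) = Gamma b * Gamma (c - b) / Gamma c * of_real s powr (b - c)"
    using absolutely_integrable_Mellin_shift[OF s b c] by simp
  then have *: "?f absolutely_integrable_on {s<..} \<and>
      integral {s<..} ?f = Gamma b * Gamma (c - b) / Gamma c * of_real s powr (b - c)"
    by (subst (asm) has_absolute_integral_change_of_variables_real[where h = "\<lambda>_. 1", unfolded img])
       (auto intro!: derivative_eq_intros inj_onI simp: img)
  have sub: "{s<..} \<subseteq> {0<..}" using s by auto
  show "(\<lambda>u. if s < u then ?f u else 0) absolutely_integrable_on {0<..}"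
    using absolutely_integrable_restrict_iff[OF sub, of ?f] * by simp
  show "integral {0<..} (\<lambda>u. if s < u then ?f u else 0) = Gamma b * Gamma (c - b) / Gamma c * of_real s powr (b - c)"
    using integral_restrict_subset[OF sub, of ?f] * by simp
qed

text \<open>Exchange the integrations over the triangle of all \<open>s < u\<close>: for fixed
  \<open>s\<close>, the integral over \<open>u\<close> is the one of \<open>Mellin_kernel\<close>, a
  constant times \<open>of_real s powr (b - c)\<close>.\<close>

lemma Mellin_fractional_integral:
  fixes F :: "real \<Rightarrow> complex"
  assumes b: "Re b > 0" and c: "Re b < Re c"
    and F: "(\<lambda>s. of_real s powr (b - c) * F s) absolutely_integrable_on {0<..}"
    and ex: "\<And>u. u > 0 \<Longrightarrow> (\<lambda>s. of_real (u - s) powr (b - 1) * F s) absolutely_integrable_on {0<..<u}"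
  shows "(\<lambda>u. of_real u powr (- c) * integral {0<..<u} (\<lambda>s. of_real (u - s) powr (b - 1) * F s))
      absolutely_integrable_on {0<..}"
    and "integral {0<..} (\<lambda>u. of_real u powr (- c) * integral {0<..<u} (\<lambda>s. of_real (u - s) powr (b - 1) * F s)) =
      Gamma b * Gamma (c - b) / Gamma c * integral {0<..} (\<lambda>s. of_real s powr (b - c) * F s)"
proof -
  define k :: "complex \<Rightarrow> complex \<Rightarrow> real \<Rightarrow> real \<Rightarrow> complex" where
    "k b c s u = (if s < u then of_real u powr (- c) * of_real (u - s) powr (b - 1) else 0)" for b c s u
  define R :: "complex \<Rightarrow> complex \<Rightarrow> complex" where "R b c = Gamma b * Gamma (c - b) / Gamma c" for b c
  define K where "K s u = k b c s u * F s" for s u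
  let ?G = "\<lambda>s. of_real s powr (b - c) * F s"
  have k: "k b c s absolutely_integrable_on {0<..}"
      "integral {0<..} (k b c s) = R b c * of_real s powr (b - c)"
    if "s > 0" "Re b > 0" "Re b < Re c" for s b c
    using Mellin_kernel[OF that] by (simp_all add: k_def[abs_def] R_def)
  have inner: "K s absolutely_integrable_on {0<..}" if "s > 0" for s
    unfolding K_def by (intro set_integrable_mult_left k that b c)
  have inner_eq: "integral {0<..} (K s) = R b c * ?G s" if "s > 0" for s
    unfolding K_def using k(2)[OF that b c] by simp
  have Keq: "K s u = (if s \<in> {0<..<u} then of_real u powr (- c) * (of_real (u - s) powr (b - 1) * F s) else 0)"
    if "s > 0" for s u using that by (simp add: K_def k_def)
  have outer: "(\<lambda>s. K s u) absolutely_integrable_on {0<..}" 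
     "integral {0<..} (\<lambda>s. K s u) = of_real u powr (- c) * integral {0<..<u} (\<lambda>s. of_real (u - s) powr (b - 1) * F s)"
     if u: "u > 0" for u
  proof -
    let ?g = "\<lambda>s. of_real u powr (- c) * (of_real (u - s) powr (b - 1) * F s)"
    have sub: "{0<..<u} \<subseteq> {0<..}" by auto
    have g: "?g absolutely_integrable_on {0<..<u}" by (intro set_integrable_mult_right ex u)
    then have "(\<lambda>s. if s \<in> {0<..<u} then ?g s else 0) absolutely_integrable_on {0<..}"
      by (simp only: absolutely_integrable_restrict_iff[OF sub])
    then show "(\<lambda>s. K s u) absolutely_integrable_on {0<..}"
      by (subst set_integrable_cong[OF refl refl Keq]) auto
    have "integral {0<..} (\<lambda>s. K s u) = integral {0<..} (\<lambda>s. if s \<in> {0<..<u} then ?g s else 0)"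
      by (intro integral_cong Keq) auto
    also have "\<dots> = integral {0<..<u} ?g"
      by (rule integral_restrict_subset[OF sub])
    finally show "integral {0<..} (\<lambda>s. K s u) = of_real u powr (- c) * integral {0<..<u} (\<lambda>s. of_real (u - s) powr (b - 1) * F s)"
      by simp
  qed
  have norm_k: "complex_of_real (norm (k b c s u)) = k (of_real (Re b)) (of_real (Re c)) s u" if "s > 0" for s u
  proof -
    have P: "complex_of_real (norm (complex_of_real x powr a)) = of_real x powr of_real (Re a)" if "x > 0" for x a
      using that by (simp add: norm_powr_real_powr powr_of_real)
    show ?thesis
    proof (cases "s < u")
      case True
      then show ?thesis using P[of "u - s" "b - 1"] P[of u "- c"] that
        by (simp add: k_def norm_mult)
    qed (simp add: k_def)
  qed
  \<comment> \<open>As the norm of \<open>k\<close> is \<open>k\<close> at the real parts, the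
    integral of \<open>norm (K s u)\<close> over \<open>u\<close> is a constant multiple of
    \<open>norm (?G s)\<close>, which is integrable by assumption.\<close>
  have "(\<lambda>s. R (of_real (Re b)) (of_real (Re c)) * complex_of_real (norm (?G s))) absolutely_integrable_on {0<..}"
    using absolutely_integrable_linear[OF set_integrable_norm[OF F] bounded_linear_of_real[where 'a = complex]]
    by (intro set_integrable_mult_right) (simp only: o_def)
  then have "(\<lambda>s. complex_of_real (integral {0<..} (\<lambda>u. norm (K s u)))) absolutely_integrable_on {0<..}"
  proof (subst set_integrable_cong[OF refl refl])
    fix s :: real assume "s \<in> {0<..}"
    then have s: "s > 0" by simp
    have "(\<lambda>u. norm (K s u)) integrable_on {0<..}"
      using inner[OF s] absolutely_integrable_on_def by blast
    then have "complex_of_real (integral {0<..} (\<lambda>u. norm (K s u))) = integral {0<..} (\<lambda>u. complex_of_real (norm (K s u)))"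
      by (rule integral_linear[OF _ bounded_linear_of_real, unfolded o_def, symmetric])
    also have "\<dots> = integral {0<..} (\<lambda>u. k (of_real (Re b)) (of_real (Re c)) s u * of_real (norm (F s)))"
      using s by (intro integral_cong) (simp add: K_def norm_k norm_mult)
    also have "\<dots> = R (of_real (Re b)) (of_real (Re c)) * (of_real s powr (of_real (Re b) - of_real (Re c)) * of_real (norm (F s)))"
      using k(2)[OF s, of "of_real (Re b)" "of_real (Re c)"] b c by simp
    also have "of_real s powr (of_real (Re b) - of_real (Re c)) = complex_of_real (norm (complex_of_real s powr (b - c)))"
      using s by (simp add: norm_powr_real_powr flip: of_real_diff powr_of_real)
    finally show "complex_of_real (integral {0<..} (\<lambda>u. norm (K s u))) =
        R (of_real (Re b)) (of_real (Re c)) * complex_of_real (norm (?G s))"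
      by (simp add: norm_mult)
  qed
  from absolutely_integrable_linear[OF this bounded_linear_Re]
  have norm: "(\<lambda>s. integral {0<..} (\<lambda>u. norm (K s u))) absolutely_integrable_on {0<..}"
    by (simp add: o_def)
  have meas: "(\<lambda>(s, u). K s u) \<in> borel_measurable (lebesgue_on {0<..} \<Otimes>\<^sub>M lebesgue_on {0<..})"
  proof -
    have [measurable]: "(\<lambda>x::real. x) \<in> borel_measurable (lebesgue_on {0<..})"
      by (intro continuous_imp_measurable_on_sets_lebesgue continuous_intros) auto
    have "?G \<in> borel_measurable (lebesgue_on {0<..})"
      using F integrable_lebesgue_on_eq(1)[of "{0<..}" ?G] by auto
    \<comment> \<open>Multiplying by the inverse power recovers the measurability of
      \<open>F\<close> from that of the weighted function.\<close>
    then have "(\<lambda>s. of_real s powr (c - b) * ?G s) \<in> borel_measurable (lebesgue_on {0<..})"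
      by measurable
    then have [measurable]: "F \<in> borel_measurable (lebesgue_on {0<..})"
      by (rule measurable_cong[THEN iffD1, rotated]) (simp add: powr_diff)
    show ?thesis unfolding K_def k_def by measurable
  qed
  have Fu: "(\<lambda>u. integral {0<..} (\<lambda>s. K s u)) absolutely_integrable_on {0<..}"
     "integral {0<..} (\<lambda>u. integral {0<..} (\<lambda>s. K s u)) = integral {0<..} (\<lambda>s. integral {0<..} (K s))"
    by (rule Fubini_absolutely_integrable[OF _ _ meas _ _ norm]; simp add: inner outer)+
  show "(\<lambda>u. of_real u powr (- c) * integral {0<..<u} (\<lambda>s. of_real (u - s) powr (b - 1) * F s))
      absolutely_integrable_on {0<..}"
    using Fu(1) by (subst set_integrable_cong[OF refl refl outer(2)[symmetric]]) auto
  have "integral {0<..} (\<lambda>u. of_real u powr (- c) * integral {0<..<u} (\<lambda>s. of_real (u - s) powr (b - 1) * F s)) =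
     integral {0<..} (\<lambda>u. integral {0<..} (\<lambda>s. K s u))"
    by (intro integral_cong outer(2)[symmetric]) auto
  also have "\<dots> = integral {0<..} (\<lambda>s. R b c * ?G s)"
    unfolding Fu(2) by (intro integral_cong inner_eq) auto
  finally show "integral {0<..} (\<lambda>u. of_real u powr (- c) * integral {0<..<u} (\<lambda>s. of_real (u - s) powr (b - 1) * F s)) =
      Gamma b * Gamma (c - b) / Gamma c * integral {0<..} (\<lambda>s. of_real s powr (b - c) * F s)"
    by (simp add: R_def)
qed

section \<open>Decay of intermediate derivatives\<close>

text \<open>The mean value inequality for \<open>\<lambda>x. f x - x *\<^sub>R c\<close>, whose
  derivative is \<open>f' x - c\<close>.\<close>

lemma vector_derivative_norm_bound:
  fixes f :: "real \<Rightarrow> 'a :: real_normed_vector"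
  assumes "a \<le> b" and d: "\<And>x. x \<in> {a..b} \<Longrightarrow> (f has_vector_derivative f' x) (at x within {a..b})"
    and B: "\<And>x. x \<in> {a..b} \<Longrightarrow> norm (f' x - c) \<le> B"
  shows "norm (f b - f a - (b - a) *\<^sub>R c) \<le> (b - a) * B"
proof -
  have "norm ((f b - b *\<^sub>R c) - (f a - a *\<^sub>R c)) \<le> B * norm (b - a)"
  proof (rule differentiable_bound[where f = "\<lambda>x. f x - x *\<^sub>R c" and f' = "\<lambda>x t. t *\<^sub>R (f' x - c)" and S = "{a..b}"])
    fix x assume x: "x \<in> {a..b}"
    have "((\<lambda>x. f x - x *\<^sub>R c) has_vector_derivative (f' x - c)) (at x within {a..b})"
      using d[OF x] by (auto intro!: derivative_eq_intros)
    then show "((\<lambda>x. f x - x *\<^sub>R c) has_derivative (\<lambda>t. t *\<^sub>R (f' x - c))) (at x within {a..b})"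
      by (simp add: has_vector_derivative_def)
    show "onorm (\<lambda>t. t *\<^sub>R (f' x - c)) \<le> B"
      using B[OF x] by (intro onorm_bound) (auto simp: mult.commute[of B] mult_left_mono intro: order_trans[OF norm_ge_zero])
  qed (use assms in auto)
  then show ?thesis using assms(1) by (simp add: algebra_simps)
qed

text \<open>The bound comes from the \<open>m\<close>-th forward difference with step \<open>h\<close>, taken one difference at a time.\<close>

lemma derivative_le_oscillation:
  fixes z :: "nat \<Rightarrow> real \<Rightarrow> 'a :: real_normed_vector"
  assumes "h \<ge> 0"
    and "\<And>j v. j < m \<Longrightarrow> v \<in> {u..u + real m * h} \<Longrightarrow> (z j has_vector_derivative z (Suc j) v) (at v)"
    and "\<And>v. v \<in> {u..u + real m * h} \<Longrightarrow> norm (z 0 v) \<le> M"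
    and "\<And>v. v \<in> {u..u + real m * h} \<Longrightarrow> norm (z m v - c) \<le> E"
  shows "h ^ m * norm c \<le> 2 ^ m * M + h ^ m * E"
  using assms(2-)
proof (induction m arbitrary: z c M E)
  case 0
  then show ?case using norm_triangle_ineq4[of "z 0 u" "z 0 u - c"] by (force intro: order_trans)
next
  case (Suc m)
  \<comment> \<open>Differencing commutes with differentiation, so \<open>w\<close> is again a chain
    of derivatives, on an interval shorter by \<open>h\<close>. It at most doubles the bound
    \<open>M\<close>, and the mean value inequality puts \<open>w m\<close> within
    \<open>h * E\<close> of \<open>h *\<^sub>R c\<close>.\<close>
  define w where "w j v = z j (v + h) - z j v" for j v
  have in1: "v \<in> {u..u + real (Suc m) * h}" "v + h \<in> {u..u + real (Suc m) * h}"
      "{v..v + h} \<subseteq> {u..u + real (Suc m) * h}"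
    if "v \<in> {u..u + real m * h}" for v
    using that \<open>h \<ge> 0\<close> by (auto simp: algebra_simps)
  have "h ^ m * norm (h *\<^sub>R c) \<le> 2 ^ m * (2 * M) + h ^ m * (h * E)"
  proof (rule Suc.IH[of w])
    fix j v assume j: "j < m" and v: "v \<in> {u..u + real m * h}"
    have "((\<lambda>t. t + h) has_vector_derivative 1) (at v)"
      by (auto intro!: derivative_eq_intros simp: has_real_derivative_iff_has_vector_derivative[symmetric])
    then have "((\<lambda>t. z j (t + h)) has_vector_derivative z (Suc j) (v + h)) (at v)"
      using vector_diff_chain_at[of "\<lambda>t. t + h" 1 v "z j" "z (Suc j) (v + h)"] Suc.prems(1)[OF _ in1(2)[OF v], of j] j
      by (simp add: o_def)
    then show "(w j has_vector_derivative w (Suc j) v) (at v)"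
      unfolding w_def[abs_def] using Suc.prems(1)[OF _ in1(1)[OF v], of j] j
      by (auto intro: has_vector_derivative_diff)
  next
    fix v assume v: "v \<in> {u..u + real m * h}"
    show "norm (w 0 v) \<le> 2 * M"
      using Suc.prems(2)[OF in1(1)[OF v]] Suc.prems(2)[OF in1(2)[OF v]] norm_triangle_ineq4[of "z 0 (v + h)" "z 0 v"]
      unfolding w_def by linarith
    have "norm (z m (v + h) - z m v - (v + h - v) *\<^sub>R c) \<le> (v + h - v) * E"
    proof (rule vector_derivative_norm_bound)
      fix x assume "x \<in> {v..v + h}"
      then have x: "x \<in> {u..u + real (Suc m) * h}" using in1(3)[OF v] by blast
      show "(z m has_vector_derivative z (Suc m) x) (at x within {v..v + h})"
        by (rule has_vector_derivative_at_within[OF Suc.prems(1)[OF lessI x]])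
      show "norm (z (Suc m) x - c) \<le> E" by (rule Suc.prems(3)[OF x])
    qed (use \<open>h \<ge> 0\<close> in simp)
    then show "norm (w m v - h *\<^sub>R c) \<le> h * E" by (simp add: w_def)
  qed
  then show ?case using \<open>h \<ge> 0\<close> by (simp add: mult_ac)
qed

text \<open>On a dyadic interval a power weight is constant up to a factor, so it may be frozen at
  the left endpoint. The absolute value in the exponent serves both signs of
  \<open>r\<close>.\<close>

lemma powr_le_powr_dyadic:
  fixes u v r :: real
  assumes "u > 0" "v \<in> {u..2 * u}"
  shows "u powr r \<le> 2 powr \<bar>r\<bar> * v powr r"
proof (cases "r \<ge> 0")
  case True
  then have "u powr r \<le> v powr r" using assms by (intro powr_mono2) auto
  also have "\<dots> \<le> 2 powr \<bar>r\<bar> * v powr r" by (simp add: ge_one_powr_ge_zero mult_le_cancel_right1)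
  finally show ?thesis .
next
  case False
  then have "(2 * u) powr r \<le> v powr r" using assms by (intro powr_mono2') auto
  then show ?thesis using False assms by (simp add: powr_mult powr_minus field_simps)
qed

lemma powr_mult_le_iff:
  fixes u :: real
  assumes "u > 0"
  shows "u powr a * x \<le> y \<longleftrightarrow> x \<le> y * u powr (- a)"
  using assms by (simp add: powr_minus field_simps)

text \<open>The oscillation of \<open>z m\<close> on \<open>{u..2 * u}\<close> is of smaller order
  than \<open>u powr (- (r + real m))\<close>; every derivative gains one power of \<open>u\<close>,
  as scaling demands. The bound by \<open>e\<close> at each \<open>v\<close> avoids a
  supremum.\<close>

definition osc_small :: "real filter \<Rightarrow> (nat \<Rightarrow> real \<Rightarrow> 'a :: real_normed_vector) \<Rightarrow> real \<Rightarrow> nat \<Rightarrow> bool" where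
  "osc_small F z r m \<longleftrightarrow>
     (\<forall>e>0. eventually (\<lambda>u. \<forall>v\<in>{u..2 * u}. u powr (r + real m) * norm (z m v - z m u) \<le> e) F)"

text \<open>\<open>dyadic\<close> is the property shared by \<open>at_top\<close> and
  \<open>at_right 0\<close> that the interpolation uses, so both ends of the half-line are treated
  at once.\<close>

context
  fixes F :: "real filter" and z :: "nat \<Rightarrow> real \<Rightarrow> 'a :: real_normed_vector" and n :: nat and r :: real
  assumes dyadic: "\<And>P. eventually P F \<Longrightarrow> eventually (\<lambda>u. \<forall>v\<in>{u..2 * u}. P v) F"
    and pos: "eventually (\<lambda>u. u > 0) F"
    and deriv: "\<And>j u. j < n \<Longrightarrow> u > 0 \<Longrightarrow> (z j has_vector_derivative z (Suc j) u) (at u)"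
    and lim: "((\<lambda>u. u powr r * norm (z 0 u)) \<longlongrightarrow> 0) F"
begin

text \<open>If \<open>z 0\<close> is small and \<open>z m\<close> is nearly constant on
  \<open>{u..2 * u}\<close>, then \<open>z m u\<close> is small: otherwise the \<open>m\<close>-th
  difference of \<open>z 0\<close>, with a step proportional to \<open>u\<close>, would be too
  large.\<close>

lemma tendsto_of_osc_small:
  assumes "m < n" "osc_small F z r m"
  shows "((\<lambda>u. u powr (r + real m) * norm (z m u)) \<longlongrightarrow> 0) F"
proof (rule tendstoI)
  fix e :: real assume e: "e > 0"
  \<comment> \<open>The factors come from \<open>u ^ m = (real m + 1) ^ m * h ^ m\<close>, from the
    \<open>m\<close>-th difference and from freezing the weight. The 2 in the choice of
    \<open>d\<close> gives a strict inequality.\<close>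
  define C where "C = (real m + 1) ^ m * 2 ^ m * 2 powr \<bar>r\<bar>"
  have C: "C > 0" by (simp add: C_def)
  define d where "d = e / (2 * (C + 1))"
  have d: "d > 0" "(C + 1) * d < e" using e C add_pos_pos[OF e mult_pos_pos[OF C e]] by (auto simp: d_def field_simps)
  have "eventually (\<lambda>v. v powr r * norm (z 0 v) \<le> d) F"
    using order_tendstoD(2)[OF lim d(1)] by eventually_elim simp
  from dyadic[OF this] pos assms(2)[unfolded osc_small_def, rule_format, OF d(1)]
  show "eventually (\<lambda>u. dist (u powr (r + real m) * norm (z m u)) 0 < e) F"
  proof eventually_elim
    case (elim u)
    \<comment> \<open>All points up to \<open>u + real m * h\<close> must stay below
      \<open>2 * u\<close>; the added 1 also covers \<open>m = 0\<close>.\<close>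
    define h where "h = u / (real m + 1)"
    have h: "h > 0" using elim(2) by (simp add: h_def)
    have "real m * h \<le> u" using elim(2) by (simp add: h_def field_simps)
    then have sub: "{u..u + real m * h} \<subseteq> {u..2 * u}" by auto
    let ?M = "2 powr \<bar>r\<bar> * d * u powr (- r)" and ?E = "d * u powr (- (r + real m))"
    have "h ^ m * norm (z m u) \<le> 2 ^ m * ?M + h ^ m * ?E"
    proof (rule derivative_le_oscillation[of h m u z])
      fix j v assume "j < m" "v \<in> {u..u + real m * h}"
      then show "(z j has_vector_derivative z (Suc j) v) (at v)"
        using assms(1) elim(2) by (intro deriv) auto
    next
      fix v assume "v \<in> {u..u + real m * h}"
      then have v: "v \<in> {u..2 * u}" using sub by blast
      have "u powr r * norm (z 0 v) \<le> 2 powr \<bar>r\<bar> * (v powr r * norm (z 0 v))"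
        using powr_le_powr_dyadic[OF elim(2) v, of r] by (simp add: mult_right_mono mult.assoc[symmetric])
      also have "\<dots> \<le> 2 powr \<bar>r\<bar> * d" using elim(1) v by (intro mult_left_mono) auto
      finally show "norm (z 0 v) \<le> ?M" by (simp only: powr_mult_le_iff[OF elim(2)])
      show "norm (z m v - z m u) \<le> ?E"
        using elim(3) v powr_mult_le_iff[OF elim(2)] by blast
    qed (use h in simp)
    then have "u powr (r + real m) * (h ^ m * norm (z m u)) \<le> u powr (r + real m) * (2 ^ m * ?M + h ^ m * ?E)"
      by (intro mult_left_mono) auto
    also have "\<dots> = u ^ m * 2 ^ m * 2 powr \<bar>r\<bar> * d + h ^ m * d"
    proof -
      have "u powr (r + real m) = u powr r * u ^ m" "u powr (- r) = 1 / u powr r"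
        using elim(2) by (simp_all add: powr_add powr_realpow powr_minus divide_inverse)
      moreover from this(1) have "u powr (- (r + real m)) = 1 / (u powr r * u ^ m)"
        using powr_minus[of u "r + real m"] by (simp add: divide_inverse)
      ultimately show ?thesis using elim(2) by (simp add: field_simps)
    qed
    also have "u ^ m = (real m + 1) ^ m * h ^ m"
      by (simp add: h_def power_divide)
    also have "(real m + 1) ^ m * h ^ m * 2 ^ m * 2 powr \<bar>r\<bar> * d + h ^ m * d = h ^ m * ((C + 1) * d)"
      by (simp add: C_def algebra_simps)
    finally have "h ^ m * (u powr (r + real m) * norm (z m u)) \<le> h ^ m * ((C + 1) * d)"
      by (simp add: mult_ac)
    then have "u powr (r + real m) * norm (z m u) \<le> (C + 1) * d" using h by simp
    then show ?case using d(2) by simp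
  qed
qed

text \<open>By the mean value inequality on \<open>{u..v}\<close>: the length, at most
  \<open>u\<close>, supplies the power by which the weights of \<open>z m\<close> and
  \<open>z (Suc m)\<close> differ.\<close>

lemma osc_small_of_tendsto:
  assumes m: "m < n" and l: "((\<lambda>u. u powr (r + real (Suc m)) * norm (z (Suc m) u)) \<longlongrightarrow> 0) F"
  shows "osc_small F z r m"
  unfolding osc_small_def
proof (intro allI impI)
  fix e :: real assume e: "e > 0"
  define C where "C = 2 powr \<bar>r + real (Suc m)\<bar>"
  have C: "C > 0" by (simp add: C_def)
  define d where "d = e / C"
  have d: "d > 0" "C * d = e" using e C by (auto simp: d_def)
  have "eventually (\<lambda>v. v powr (r + real (Suc m)) * norm (z (Suc m) v) \<le> d) F"
    using order_tendstoD(2)[OF l d(1)] by (rule eventually_mono) (rule less_imp_le)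
  from dyadic[OF this] pos
  show "eventually (\<lambda>u. \<forall>v\<in>{u..2 * u}. u powr (r + real m) * norm (z m v - z m u) \<le> e) F"
  proof eventually_elim
    case (elim u)
    show ?case
    proof
      fix v assume v: "v \<in> {u..2 * u}"
      let ?B = "e * u powr (- (r + real (Suc m)))"
      have "norm (z m v - z m u - (v - u) *\<^sub>R 0) \<le> (v - u) * ?B"
      proof (rule vector_derivative_norm_bound)
        fix x assume x: "x \<in> {u..v}"
        show "(z m has_vector_derivative z (Suc m) x) (at x within {u..v})"
          using x elim(2) m by (intro has_vector_derivative_at_within[OF deriv]) auto
        have x2: "x \<in> {u..2 * u}" using x v by auto
        have "u powr (r + real (Suc m)) * norm (z (Suc m) x) \<le> C * (x powr (r + real (Suc m)) * norm (z (Suc m) x))"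
          using mult_right_mono[OF powr_le_powr_dyadic[OF elim(2) x2, of "r + real (Suc m)"] norm_ge_zero]
          unfolding C_def by (simp only: mult.assoc)
        also have "\<dots> \<le> C * d" using elim(1) x2 C by (intro mult_left_mono) auto
        finally show "norm (z (Suc m) x - 0) \<le> ?B"
          unfolding d(2) powr_mult_le_iff[OF elim(2)] diff_zero .
      qed (use v in auto)
      also have "\<dots> \<le> u * ?B" using v e by (intro mult_right_mono) auto
      also have "u * ?B = e * u powr (- (r + real m))"
      proof -
        have "u * u powr (- (r + real (Suc m))) = u powr (- (r + real m))"
        proof -
          have "1 + - (r + real (Suc m)) = - (r + real m)" by simp
          with powr_mult_base[OF less_imp_le[OF elim(2)], of "- (r + real (Suc m))"]
          show ?thesis by (simp only:)
        qed
        then show ?thesis by (simp only: mult.left_commute)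
      qed
      finally show "u powr (r + real m) * norm (z m v - z m u) \<le> e"
        unfolding powr_mult_le_iff[OF elim(2)] scaleR_zero_right diff_zero .
    qed
  qed
qed

text \<open>Downward induction from the top index \<open>N\<close>: decay of
  \<open>z (Suc m)\<close> makes the oscillation of \<open>z m\<close> small, and this together with
  the decay of \<open>z 0\<close> gives decay of \<open>z m\<close>.\<close>

lemma derivatives_tendsto_0:
  assumes "n = Suc N" "osc_small F z r N" "j < n"
  shows "((\<lambda>u. u powr (r + real j) * norm (z j u)) \<longlongrightarrow> 0) F"
proof -
  have "j \<le> N" using assms by simp
  then show ?thesis
  proof (induction rule: inc_induct)
    case base
    show ?case by (rule tendsto_of_osc_small) (use assms in simp_all)
  next
    case (step m)
    then have m: "m < n" using assms(1) by simp
    show ?case by (rule tendsto_of_osc_small[OF m osc_small_of_tendsto[OF m step(3)]])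
  qed
qed

end

section \<open>Integration by parts on the half-line\<close>

lemma dyadic_eventually_at_top:
  fixes P :: "real \<Rightarrow> bool"
  assumes "eventually P at_top"
  shows "eventually (\<lambda>u. \<forall>v\<in>{u..2 * u}. P v) at_top"
  using assms unfolding eventually_at_top_linorder by (meson atLeastAtMost_iff order_trans)

lemma dyadic_eventually_at_right_0:
  fixes P :: "real \<Rightarrow> bool"
  assumes "eventually P (at_right 0)"
  shows "eventually (\<lambda>u. \<forall>v\<in>{u..2 * u}. P v) (at_right 0)"
proof -
  obtain b where b: "b > 0" "\<And>y. 0 < y \<Longrightarrow> y < b \<Longrightarrow> P y"
    using assms by (auto simp: eventually_at_right_field)
  have "\<forall>v\<in>{u..2 * u}. P v" if "0 < u" "u < b / 2" for u
    using that by (auto intro!: b(2))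
  then show ?thesis
    using b(1) unfolding eventually_at_right_field by (intro exI[of _ "b / 2"]) auto
qed

text \<open>Dominated convergence with majorant \<open>norm (G x)\<close>, since the moving interval
  eventually leaves every point behind. The parameter \<open>a\<close> turns both ends into limits
  at infinity: \<open>a t\<close> is \<open>t\<close> for one and \<open>inverse t\<close> for the
  other.\<close>

lemma tendsto_integral_dyadic_0:
  fixes G a :: "real \<Rightarrow> real"
  assumes G: "G absolutely_integrable_on {0<..}"
    and a: "eventually (\<lambda>t. a t > 0) at_top"
    and x: "\<And>x. x > 0 \<Longrightarrow> eventually (\<lambda>t. x \<notin> {a t..2 * a t}) at_top"
  shows "((\<lambda>t. integral {a t..2 * a t} G) \<longlongrightarrow> 0) at_top"
proof -
  let ?g = "\<lambda>x. indicator {0<..} x *\<^sub>R G x"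
  have g: "integrable lebesgue ?g" using G by (simp add: set_integrable_def)
  have "((\<lambda>t. LINT x|lebesgue. indicator {a t..2 * a t} x *\<^sub>R ?g x) \<longlongrightarrow> (LINT x::real|lebesgue. 0)) at_top"
  proof (rule integral_dominated_convergence_at_top[where w = "\<lambda>x. norm (?g x)"])
    show "\<forall>\<^sub>F t in at_top. AE x in lebesgue. norm (indicator {a t..2 * a t} x *\<^sub>R ?g x) \<le> norm (?g x)"
      by (intro always_eventually allI AE_I2) (auto simp: indicator_def)
    show "AE x in lebesgue. ((\<lambda>t. indicator {a t..2 * a t} x *\<^sub>R ?g x) \<longlongrightarrow> 0) at_top"
    proof (rule AE_I2)
      fix y :: real
      show "((\<lambda>t. indicator {a t..2 * a t} y *\<^sub>R ?g y) \<longlongrightarrow> 0) at_top"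
      proof (cases "y > 0")
        case True
        show ?thesis by (rule tendsto_eventually, use x[OF True] in eventually_elim) simp
      qed simp
    qed
    show "(\<lambda>x. indicator {a t..2 * a t} x *\<^sub>R ?g x) \<in> borel_measurable lebesgue" for t
      by (rule borel_measurable_scaleR[OF borel_measurable_indicator borel_measurable_integrable[OF g]]) auto
    show "integrable lebesgue (\<lambda>x. norm (?g x))" by (rule integrable_norm[OF g])
  qed simp
  moreover have "eventually (\<lambda>t. (LINT x|lebesgue. indicator {a t..2 * a t} x *\<^sub>R ?g x) = integral {a t..2 * a t} G) at_top"
    using a
  proof eventually_elim
    case (elim t)
    have eq: "(\<lambda>x. indicator {a t..2 * a t} x *\<^sub>R ?g x) = (\<lambda>x. indicator {a t..2 * a t} x *\<^sub>R G x)"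
      using elim by (auto simp: indicator_def fun_eq_iff)
    have "G absolutely_integrable_on {a t..2 * a t}"
      by (rule set_integrable_subset[OF G]) (use elim in auto)
    from set_lebesgue_integral_eq_integral(2)[OF this]
    show ?case unfolding eq by (simp add: set_lebesgue_integral_def)
  qed
  ultimately show ?thesis by (simp add: tendsto_cong)
qed

lemma absolutely_integrable_dyadic_tendsto_0:
  fixes G :: "real \<Rightarrow> real"
  assumes G: "G absolutely_integrable_on {0<..}"
  shows "((\<lambda>u. integral {u..2 * u} G) \<longlongrightarrow> 0) at_top"
    and "((\<lambda>u. integral {u..2 * u} G) \<longlongrightarrow> 0) (at_right 0)"
proof -
  show "((\<lambda>u. integral {u..2 * u} G) \<longlongrightarrow> 0) at_top"
  proof (rule tendsto_integral_dyadic_0[OF G eventually_gt_at_top])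
    fix x :: real
    show "eventually (\<lambda>t. x \<notin> {t..2 * t}) at_top"
      using eventually_gt_at_top[of x] by eventually_elim simp
  qed
  have "((\<lambda>t. integral {inverse t..2 * inverse t} G) \<longlongrightarrow> 0) at_top"
  proof (rule tendsto_integral_dyadic_0[OF G])
    show "eventually (\<lambda>t::real. inverse t > 0) at_top"
      using eventually_gt_at_top[of 0] by eventually_elim simp
    fix x :: real assume x: "x > 0"
    show "eventually (\<lambda>t. x \<notin> {inverse t..2 * inverse t}) at_top"
      using eventually_gt_at_top[of "2 / x"] eventually_gt_at_top[of 0]
      by eventually_elim (use x in \<open>auto simp: field_simps\<close>)
  qed
  then show "((\<lambda>u. integral {u..2 * u} G) \<longlongrightarrow> 0) (at_right 0)"
    unfolding filterlim_at_right_to_top .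
qed

section \<open>Mellin integrals of iterated derivatives\<close>

lemma has_vector_derivative_of_real_powr:
  assumes "u > 0"
  shows "((\<lambda>u. complex_of_real u powr a) has_vector_derivative a * of_real u powr (a - 1)) (at u)"
  using assms by (intro has_vector_derivative_real_field has_field_derivative_powr) auto

lemma norm_of_real_powr:
  assumes "u > 0"
  shows "norm (complex_of_real u powr a) = u powr Re a"
  using assms by (simp add: norm_powr_real_powr)

text \<open>The start of the downward induction. The increment of \<open>z N\<close> is the integral
  of \<open>z (Suc N)\<close>; with the weight moved under the integral it is bounded by a constant
  times a dyadic integral that tends to 0.\<close>

lemma osc_small_of_integrable:
  fixes z :: "nat \<Rightarrow> real \<Rightarrow> complex"
  assumes dyadic: "\<And>P. eventually P F \<Longrightarrow> eventually (\<lambda>u. \<forall>v\<in>{u..2 * u}. P v) F"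
    and pos: "eventually (\<lambda>u. u > 0) F"
    and deriv: "\<And>u. u > 0 \<Longrightarrow> (z N has_vector_derivative z (Suc N) u) (at u)"
    and int: "(\<lambda>u. of_real u powr a * z (Suc N) u) absolutely_integrable_on {0<..}"
    and lim: "((\<lambda>u. integral {u..2 * u} (\<lambda>s. norm (of_real s powr a * z (Suc N) s))) \<longlongrightarrow> 0) F"
    and r: "r + real N = Re a"
  shows "osc_small F z r N"
  unfolding osc_small_def r
proof (intro allI impI)
  fix e :: real assume e: "e > 0"
  define C where "C = 2 powr \<bar>Re a\<bar>"
  have C: "C > 0" by (simp add: C_def)
  define d where "d = e / C"
  have d: "d > 0" "C * d = e" using e C by (auto simp: d_def)
  let ?G = "\<lambda>s. norm (of_real s powr a * z (Suc N) s)"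
  show "eventually (\<lambda>u. \<forall>v\<in>{u..2 * u}. u powr Re a * norm (z N v - z N u) \<le> e) F"
    using order_tendstoD(2)[OF lim d(1)] pos
  proof eventually_elim
    case (elim u)
    show ?case
    proof
      fix v assume v: "v \<in> {u..2 * u}"
      have G: "?G absolutely_integrable_on {u..2 * u}"
        by (rule set_integrable_subset[OF set_integrable_norm[OF int]]) (use elim in auto)
      have Gv: "?G absolutely_integrable_on {u..v}"
        by (rule set_integrable_subset[OF G]) (use v in auto)
      \<comment> \<open>The gauge integral of a derivative that exists everywhere is the increment,
        however irregular that derivative is.\<close>
      have zi: "(z (Suc N) has_integral (z N v - z N u)) {u..v}"
        using v elim by (intro fundamental_theorem_of_calculus has_vector_derivative_at_within[OF deriv]) auto
      then have "u powr Re a * norm (z N v - z N u) = norm (integral {u..v} (\<lambda>s. of_real (u powr Re a) * z (Suc N) s))"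
        by (simp add: integral_unique norm_mult)
      also have "\<dots> \<le> integral {u..v} (\<lambda>s. C * ?G s)"
      proof (rule Henstock_Kurzweil_Integration.integral_norm_bound_integral)
        show "(\<lambda>s. of_real (u powr Re a) * z (Suc N) s) integrable_on {u..v}"
          using zi by (intro integrable_on_mult_right) (auto simp: has_integral_iff)
        show "(\<lambda>s. C * ?G s) integrable_on {u..v}"
          using Gv by (intro integrable_on_mult_right) (auto simp: absolutely_integrable_on_def)
        fix s assume "s \<in> {u..v}"
        then have s: "s \<in> {u..2 * u}" "s > 0" using v elim by auto
        show "norm (of_real (u powr Re a) * z (Suc N) s) \<le> C * ?G s"
          using mult_right_mono[OF powr_le_powr_dyadic[OF elim(2) s(1), of "Re a"], of "norm (z (Suc N) s)"] s(2)
          by (simp add: norm_mult norm_of_real_powr C_def)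
      qed
      also have "\<dots> = C * integral {u..v} ?G" by simp
      also have "\<dots> \<le> C * integral {u..2 * u} ?G"
        using G Gv C v by (intro mult_left_mono integral_subset_le) (auto simp: absolutely_integrable_on_def)
      also have "\<dots> \<le> e" using mult_left_mono[OF less_imp_le[OF elim(1)], of C] C d(2) by simp
      finally show "u powr Re a * norm (z N v - z N u) \<le> e" .
    qed
  qed
qed

text \<open>All \<open>n\<close> integrations by parts at once: \<open>B\<close> is the sum of the
  boundary terms, and its derivative telescopes to \<open>g\<close>, the difference of the two
  integrands with the constant included. The claim is then that \<open>B\<close> vanishes at both
  ends.\<close>

lemma Mellin_iterated_derivative:
  fixes z :: "nat \<Rightarrow> real \<Rightarrow> complex" and p :: complex
  assumes n: "n > 0"
    and deriv: "\<And>j u. j < n \<Longrightarrow> u > 0 \<Longrightarrow> (z j has_vector_derivative z (Suc j) u) (at u)"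
    and int_n: "(\<lambda>u. of_real u powr (p - 1) * z n u) absolutely_integrable_on {0<..}"
    and int_0: "(\<lambda>u. of_real u powr (p - 1 - of_nat n) * z 0 u) absolutely_integrable_on {0<..}"
    and lim_0: "((\<lambda>u. u powr (Re p - real n) * norm (z 0 u)) \<longlongrightarrow> 0) (at_right 0)"
    and lim_top: "((\<lambda>u. u powr (Re p - real n) * norm (z 0 u)) \<longlongrightarrow> 0) at_top"
  shows "integral {0<..} (\<lambda>u. of_real u powr (p - 1) * z n u) =
    pochhammer (1 - p) n * integral {0<..} (\<lambda>u. of_real u powr (p - 1 - of_nat n) * z 0 u)"
proof -
  define B where "B u = (\<Sum>j<n. pochhammer (1 - p) j * of_real u powr (p - 1 - of_nat j) * z (n - 1 - j) u)" for u
  define g where "g u = of_real u powr (p - 1) * z n u - pochhammer (1 - p) n * (of_real u powr (p - 1 - of_nat n) * z 0 u)" for u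
  obtain N where N: "n = Suc N" using n by (cases n) auto
  have dB: "(B has_vector_derivative g u) (at u)" if u: "u > 0" for u
  proof -
    \<comment> \<open>The \<open>j\<close>-th summand of \<open>B\<close> has derivative
      \<open>T j - T (Suc j)\<close>: differentiating the power yields \<open>p - 1 - j\<close>, the
      negative of the new factor of \<open>pochhammer (1 - p) (Suc j)\<close>.\<close>
    define T where "T j = pochhammer (1 - p) j * of_real u powr (p - 1 - of_nat j) * z (n - j) u" for j
    have "(B has_vector_derivative (\<Sum>j<n. T j - T (Suc j))) (at u)"
      unfolding B_def
    proof (rule has_vector_derivative_sum)
      fix j assume "j \<in> {..<n}"
      then have j: "j < n" "n - 1 - j < n" "Suc (n - 1 - j) = n - j" by auto
      have "((\<lambda>u. pochhammer (1 - p) j * of_real u powr (p - 1 - of_nat j)) has_vector_derivative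
          pochhammer (1 - p) j * ((p - 1 - of_nat j) * of_real u powr (p - 1 - of_nat j - 1))) (at u)"
        by (intro has_vector_derivative_mult_right has_vector_derivative_of_real_powr u)
      from has_vector_derivative_mult[OF this deriv[OF j(2) u]]
      show "((\<lambda>u. pochhammer (1 - p) j * of_real u powr (p - 1 - of_nat j) * z (n - 1 - j) u)
          has_vector_derivative T j - T (Suc j)) (at u)"
      proof (rule has_vector_derivative_eq_rhs)
        have "T (Suc j) = - (pochhammer (1 - p) j * ((p - 1 - of_nat j) * of_real u powr (p - 1 - of_nat j - 1))) * z (n - 1 - j) u"
          by (simp add: T_def pochhammer_Suc algebra_simps)
        then show "pochhammer (1 - p) j * of_real u powr (p - 1 - of_nat j) * z (Suc (n - 1 - j)) u +
            pochhammer (1 - p) j * ((p - 1 - of_nat j) * of_real u powr (p - 1 - of_nat j - 1)) * z (n - 1 - j) u =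
            T j - T (Suc j)"
          unfolding j(3) by (simp add: T_def)
      qed
    qed
    also have "(\<Sum>j<n. T j - T (Suc j)) = g u"
      unfolding sum_lessThan_telescope' by (simp add: T_def g_def mult.assoc)
    finally show ?thesis .
  qed
  have int_g: "g absolutely_integrable_on {0<..}"
    unfolding g_def by (intro set_integral_diff set_integrable_mult_right int_n int_0)
  \<comment> \<open>For either end: \<open>tail\<close> controls the oscillation of the highest
    function \<open>z N\<close>, \<open>lim\<close> the size of \<open>z 0\<close>, and
    interpolation gives every boundary term in between.\<close>
  have B0: "(B \<longlongrightarrow> 0) F"
    if dyadic: "\<And>P. eventually P F \<Longrightarrow> eventually (\<lambda>u. \<forall>v\<in>{u..2 * u}. P v) F"
      and pos: "eventually (\<lambda>u. u > 0) F"
      and tail: "((\<lambda>u. integral {u..2 * u} (\<lambda>s. norm (of_real s powr (p - 1) * z n s))) \<longlongrightarrow> 0) F"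
      and lim: "((\<lambda>u. u powr (Re p - real n) * norm (z 0 u)) \<longlongrightarrow> 0) F"
    for F
    unfolding B_def
  proof (rule tendsto_null_sum)
    fix j assume "j \<in> {..<n}"
    then have j: "j < n" "n - 1 - j < n" by auto
    have osc: "osc_small F z (Re p - real n) N"
      using dyadic pos deriv[of N] int_n tail unfolding N by (intro osc_small_of_integrable[where a = "p - 1"]) auto
    have "((\<lambda>u. u powr (Re p - real n + real (n - 1 - j)) * norm (z (n - 1 - j) u)) \<longlongrightarrow> 0) F"
      by (rule derivatives_tendsto_0[OF dyadic pos deriv lim N osc j(2)])
    then have "((\<lambda>u. norm (pochhammer (1 - p) j) * (u powr (Re p - real n + real (n - 1 - j)) * norm (z (n - 1 - j) u))) \<longlongrightarrow> 0) F"
      by (rule tendsto_mult_right_zero)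
    then have "((\<lambda>u. norm (pochhammer (1 - p) j * of_real u powr (p - 1 - of_nat j) * z (n - 1 - j) u)) \<longlongrightarrow> 0) F"
    proof (rule Lim_transform_eventually)
      have e: "Re p - real n + real (n - 1 - j) = Re (p - 1 - of_nat j)" using j(1) by (simp add: of_nat_diff)
      show "eventually (\<lambda>u. norm (pochhammer (1 - p) j) * (u powr (Re p - real n + real (n - 1 - j)) * norm (z (n - 1 - j) u)) =
          norm (pochhammer (1 - p) j * of_real u powr (p - 1 - of_nat j) * z (n - 1 - j) u)) F"
        using pos unfolding e by eventually_elim (simp add: norm_mult norm_of_real_powr)
    qed
    then show "((\<lambda>u. pochhammer (1 - p) j * of_real u powr (p - 1 - of_nat j) * z (n - 1 - j) u) \<longlongrightarrow> 0) F"
      by (rule tendsto_norm_zero_cancel)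
  qed
  note tails = absolutely_integrable_dyadic_tendsto_0[OF set_integrable_norm[OF int_n]]
  have B_top: "(B \<longlongrightarrow> 0) at_top"
    by (rule B0[OF dyadic_eventually_at_top eventually_gt_at_top tails(1) lim_top])
  have B_0: "(B \<longlongrightarrow> 0) (at_right 0)"
    by (rule B0[OF dyadic_eventually_at_right_0 eventually_at_right_less tails(2) lim_0])
  \<comment> \<open>A compact exhaustion on which the fundamental theorem applies.
    \<open>Suc i\<close> excludes \<open>inverse 0 = 0\<close>, which would put 0 into the first
    interval.\<close>
  define A where "A i = {inverse (real (Suc i))..real (Suc i)}" for i
  have UA: "(\<Union>i. A i) = {0<..}"
  proof (intro equalityI subsetI)
    fix x :: real assume "x \<in> {0<..}"
    then have x: "x > 0" by simp
    obtain i where i: "real i > max x (inverse x)" using reals_Archimedean2 by blast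
    then have "inverse (real (Suc i)) \<le> inverse (inverse x)" using x by (intro le_imp_inverse_le) auto
    with i show "x \<in> (\<Union>i. A i)" by (auto simp: A_def intro!: exI[of _ i])
  qed (auto simp: A_def intro: less_le_trans[rotated])
  have "(\<lambda>i. LINT x:A i|lebesgue. g x) \<longlonglongrightarrow> (LINT x:(\<Union>i. A i)|lebesgue. g x)"
  proof (rule set_integral_cont_up)
    show "incseq A" by (auto simp: incseq_def A_def field_simps intro: order_trans[rotated] le_imp_inverse_le)
  qed (use int_g in \<open>simp_all add: UA, simp add: A_def\<close>)
  moreover have "(LINT x:A i|lebesgue. g x) = B (real (Suc i)) - B (inverse (real (Suc i)))" for i
  proof -
    have sub: "A i \<subseteq> {0<..}" using UA by blast
    have "g absolutely_integrable_on A i"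
      by (rule set_integrable_subset[OF int_g _ sub]) (simp add: A_def)
    then have "(LINT x:A i|lebesgue. g x) = integral (A i) g"
      by (rule set_lebesgue_integral_eq_integral(2))
    also have "(g has_integral (B (real (Suc i)) - B (inverse (real (Suc i))))) (A i)"
      unfolding A_def
    proof (rule fundamental_theorem_of_calculus)
      have "inverse (real (Suc i)) \<le> 1" by (simp add: field_simps)
      then show "inverse (real (Suc i)) \<le> real (Suc i)" by simp
      show "(B has_vector_derivative g x) (at x within {inverse (real (Suc i))..real (Suc i)})"
        if "x \<in> {inverse (real (Suc i))..real (Suc i)}" for x
        by (rule has_vector_derivative_at_within[OF dB]) (use sub that in \<open>auto simp: A_def\<close>)
    qed
    then have "integral (A i) g = B (real (Suc i)) - B (inverse (real (Suc i)))" by (rule integral_unique)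
    finally show ?thesis .
  qed
  moreover have "(\<lambda>i. B (real (Suc i)) - B (inverse (real (Suc i)))) \<longlonglongrightarrow> 0 - 0"
  proof (rule tendsto_diff)
    have top: "filterlim (\<lambda>i. real (Suc i)) at_top sequentially"
      by (rule filterlim_compose[OF filterlim_real_sequentially filterlim_Suc])
    show "(\<lambda>i. B (real (Suc i))) \<longlonglongrightarrow> 0" by (rule filterlim_compose[OF B_top top])
    show "(\<lambda>i. B (inverse (real (Suc i)))) \<longlonglongrightarrow> 0"
      by (rule filterlim_compose[OF B_0 filterlim_compose[OF filterlim_inverse_at_right_top top]])
  qed
  ultimately have "(LINT x:{0<..}|lebesgue. g x) = 0"
    unfolding UA using LIMSEQ_unique by fastforce
  then have "integral {0<..} g = 0"
    using set_lebesgue_integral_eq_integral(2)[OF int_g] by simp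
  moreover have "integral {0<..} g = integral {0<..} (\<lambda>u. of_real u powr (p - 1) * z n u) -
      pochhammer (1 - p) n * integral {0<..} (\<lambda>u. of_real u powr (p - 1 - of_nat n) * z 0 u)"
    unfolding g_def using int_n int_0
    by (subst Henstock_Kurzweil_Integration.integral_diff)
       (auto simp: absolutely_integrable_on_def intro: integrable_on_mult_right)
  ultimately show ?thesis by simp
qed

text \<open>The classical case, with \<open>\<psi>\<close> the identity and weight 1: the formula
  for the fractional integral of order \<open>of_nat n - \<alpha>\<close> is followed by
  \<open>n\<close> integrations by parts, and the factor \<open>Gamma (1 - p + of_nat n)\<close>
  cancels between them.\<close>

lemma Mellin_fractional_derivative:
  fixes F :: "real \<Rightarrow> complex" and z :: "nat \<Rightarrow> real \<Rightarrow> complex" and \<alpha> p :: complex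
  assumes n: "n > 0" and \<alpha>: "Re \<alpha> < real n" and p: "Re p < 1 + Re \<alpha>"
    and F: "(\<lambda>s. of_real s powr (p - \<alpha> - 1) * F s) absolutely_integrable_on {0<..}"
    and ex: "\<And>u. u > 0 \<Longrightarrow> (\<lambda>s. of_real (u - s) powr (of_nat n - \<alpha> - 1) * F s) absolutely_integrable_on {0<..<u}"
    and z_0: "\<And>u. u > 0 \<Longrightarrow> z 0 u =
      1 / Gamma (of_nat n - \<alpha>) * integral {0<..<u} (\<lambda>s. of_real (u - s) powr (of_nat n - \<alpha> - 1) * F s)"
    and deriv: "\<And>j u. j < n \<Longrightarrow> u > 0 \<Longrightarrow> (z j has_vector_derivative z (Suc j) u) (at u)"
    and int_n: "(\<lambda>u. of_real u powr (p - 1) * z n u) absolutely_integrable_on {0<..}"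
    and lim_0: "((\<lambda>u. u powr (Re p - real n) * norm (z 0 u)) \<longlongrightarrow> 0) (at_right 0)"
    and lim_top: "((\<lambda>u. u powr (Re p - real n) * norm (z 0 u)) \<longlongrightarrow> 0) at_top"
  shows "integral {0<..} (\<lambda>u. of_real u powr (p - 1) * z n u) =
    Gamma (1 - p + \<alpha>) / Gamma (1 - p) * integral {0<..} (\<lambda>s. of_real s powr (p - \<alpha> - 1) * F s)"
proof -
  define \<beta> where "\<beta> = of_nat n - \<alpha>"
  \<comment> \<open>Chosen so that \<open>- c\<close> is the exponent left after \<open>n\<close>
    integrations by parts; \<open>\<beta> - c\<close> is then the exponent of the transform at
    \<open>p - \<alpha>\<close>.\<close>
  define c where "c = 1 + of_nat n - p"
  have eqs: "\<beta> - c = p - \<alpha> - 1" "c - \<beta> = 1 - p + \<alpha>" "- c = p - 1 - of_nat n" "c = 1 - p + of_nat n"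
    by (simp_all add: \<beta>_def c_def)
  have re: "Re \<beta> > 0" "Re \<beta> < Re c" using \<alpha> p by (simp_all add: \<beta>_def c_def)
  have G: "Gamma \<beta> \<noteq> 0" "Gamma c \<noteq> 0"
    using re by (auto simp: Gamma_eq_zero_iff elim!: nonpos_Ints_cases)
  let ?I = "\<lambda>u. integral {0<..<u} (\<lambda>s. of_real (u - s) powr (\<beta> - 1) * F s)"
  have I: "(\<lambda>u. of_real u powr (- c) * ?I u) absolutely_integrable_on {0<..}"
    "integral {0<..} (\<lambda>u. of_real u powr (- c) * ?I u) =
      Gamma \<beta> * Gamma (c - \<beta>) / Gamma c * integral {0<..} (\<lambda>s. of_real s powr (\<beta> - c) * F s)"
    by (rule Mellin_fractional_integral[OF re F[folded eqs] ex[folded \<beta>_def]]; assumption)+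
  have z0: "of_real u powr (p - 1 - of_nat n) * z 0 u = 1 / Gamma \<beta> * (of_real u powr (- c) * ?I u)" if "u \<in> {0<..}" for u
    using z_0[of u] that by (simp add: eqs \<beta>_def)
  have int_0: "(\<lambda>u. of_real u powr (p - 1 - of_nat n) * z 0 u) absolutely_integrable_on {0<..}"
    by (subst set_integrable_cong[OF refl refl z0], assumption) (rule set_integrable_mult_right, rule I(1))
  have "integral {0<..} (\<lambda>u. of_real u powr (p - 1 - of_nat n) * z 0 u) = integral {0<..} (\<lambda>u. 1 / Gamma \<beta> * (of_real u powr (- c) * ?I u))"
    by (intro integral_cong z0)
  also have "\<dots> = Gamma (c - \<beta>) / Gamma c * integral {0<..} (\<lambda>s. of_real s powr (\<beta> - c) * F s)"
    unfolding integral_mult_right I(2) using G by simp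
  finally have "integral {0<..} (\<lambda>u. of_real u powr (p - 1) * z n u) =
     pochhammer (1 - p) n * (Gamma (1 - p + \<alpha>) / Gamma c * integral {0<..} (\<lambda>s. of_real s powr (p - \<alpha> - 1) * F s))"
    using Mellin_iterated_derivative[OF n deriv int_n int_0 lim_0 lim_top] by (simp only: eqs(1,2))
  also have "\<dots> = pochhammer (1 - p) n / Gamma c * (Gamma (1 - p + \<alpha>) * integral {0<..} (\<lambda>s. of_real s powr (p - \<alpha> - 1) * F s))"
    by simp
  \<comment> \<open>The functional equation of the reciprocal Gamma function also covers the poles
    of \<open>Gamma (1 - p)\<close>. There the Pochhammer symbol vanishes, in accordance with the
    value 0 of \<open>1 / Gamma (1 - p)\<close>.\<close>
  also have "pochhammer (1 - p) n / Gamma c = 1 / Gamma (1 - p)"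
    using pochhammer_rGamma[of "1 - p" n] by (simp add: eqs(4) rGamma_inverse_Gamma divide_inverse)
  finally show ?thesis by simp
qed

section \<open>Substitution of the scale function\<close>

text \<open>\<open>\<psi>'\<close> is kept apart from \<open>deriv \<psi>\<close>: at 0 it is a
  one-sided derivative, and the two are identified on the open half-line only.\<close>

locale half_line_scale =
  fixes \<psi> \<psi>' :: "real \<Rightarrow> real"
  assumes psi_deriv: "\<And>x. x \<ge> 0 \<Longrightarrow> (\<psi> has_real_derivative \<psi>' x) (at x within {0..})"
    and psi_C1: "continuous_on {0..} \<psi>'"
    and psi_pos: "\<And>x. x \<ge> 0 \<Longrightarrow> \<psi>' x > 0"
    and psi_0: "\<psi> 0 = 0"
    and psi_top: "filterlim \<psi> at_top at_top"
begin

section \<open>The scale function as a bijection of the half-line, and its inverse\<close>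

lemma DERIV_psi: "(\<psi> has_real_derivative \<psi>' x) (at x)" if "x > 0" for x
proof -
  have "at x within {0..} = at x" using that by (intro at_within_interior) simp
  then show ?thesis using psi_deriv[of x] that by simp
qed

lemma deriv_psi: "deriv \<psi> x = \<psi>' x" if "x > 0" for x
  by (rule DERIV_imp_deriv[OF DERIV_psi[OF that]])

lemma continuous_on_psi: "continuous_on {0..} \<psi>"
  using psi_deriv by (auto intro!: DERIV_continuous_on)

lemma psi_strict_mono: "\<psi> x < \<psi> y" if "0 \<le> x" "x < y" for x y
proof (rule DERIV_pos_imp_increasing_open[OF that(2)])
  fix t assume "x < t" "t < y"
  then show "\<exists>d. (\<psi> has_real_derivative d) (at t) \<and> d > 0"
    using DERIV_psi[of t] psi_pos[of t] that by auto
next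
  show "continuous_on {x..y} \<psi>"
    by (rule continuous_on_subset[OF continuous_on_psi]) (use that in auto)
qed

lemma psi_gt_0: "\<psi> x > 0" if "x > 0" for x
  using psi_strict_mono[of 0 x] that psi_0 by simp

lemma psi_less_iff: "\<psi> x < \<psi> y \<longleftrightarrow> x < y" if "0 \<le> x" "0 \<le> y" for x y
  using psi_strict_mono[of x y] psi_strict_mono[of y x] that by (cases x y rule: linorder_cases) auto

lemma inj_on_psi: "inj_on \<psi> {0<..}"
proof (rule inj_onI)
  fix x y assume "x \<in> {0<..}" "y \<in> {0<..}" "\<psi> x = \<psi> y"
  then show "x = y" using psi_less_iff[of x y] psi_less_iff[of y x] by (cases x y rule: linorder_cases) auto
qed

lemma psi_image: "\<psi> ` {0<..} = {0<..}"
proof (intro equalityI subsetI)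
  fix u :: real assume "u \<in> {0<..}"
  then have u: "u > 0" by simp
  obtain b where b: "b > 0" "\<psi> b \<ge> u"
    using filterlim_at_top[THEN iffD1, OF psi_top, rule_format, of u] eventually_gt_at_top[of 0]
    by (metis (mono_tags, lifting) eventually_at_top_linorder order_refl linorder_linear dual_order.strict_trans1 gt_ex)
  have "\<exists>x\<ge>0. x \<le> b \<and> \<psi> x = u"
    using b u psi_0 by (intro IVT') (auto intro: continuous_on_subset[OF continuous_on_psi])
  then obtain x where "x \<ge> 0" "\<psi> x = u" by blast
  moreover from this u psi_0 have "x \<noteq> 0" by auto
  ultimately show "u \<in> \<psi> ` {0<..}" by (auto intro!: image_eqI[of _ _ x])
qed (use psi_gt_0 in auto)

definition inv_psi :: "real \<Rightarrow> real" where "inv_psi = the_inv_into {0<..} \<psi>"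

lemma inv_psi_psi [simp]: "inv_psi (\<psi> x) = x" if "x > 0" for x
  unfolding inv_psi_def using inj_on_psi that by (simp add: the_inv_into_f_f)

lemma inv_psi_gt_0 [simp]: "inv_psi u > 0" if "u > 0" for u
  using the_inv_into_into[OF inj_on_psi, of u "{0<..}"] that unfolding inv_psi_def by (simp add: psi_image)

lemma psi_inv_psi [simp]: "\<psi> (inv_psi u) = u" if "u > 0" for u
  unfolding inv_psi_def using that by (intro f_the_inv_into_f[OF inj_on_psi]) (simp add: psi_image)

lemma inv_psi_less_iff: "inv_psi u < inv_psi v \<longleftrightarrow> u < v" if "u > 0" "v > 0" for u v
  using psi_less_iff[of "inv_psi u" "inv_psi v"] that by (simp add: less_imp_le)

lemma psi_image_Ioo: "\<psi> ` {0<..<x} = {0<..<\<psi> x}" if "x > 0" for x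
proof (intro equalityI subsetI)
  fix u assume u: "u \<in> {0<..<\<psi> x}"
  then have "inv_psi u < x" using inv_psi_less_iff[of u "\<psi> x"] that psi_gt_0 by simp
  then show "u \<in> \<psi> ` {0<..<x}" using u by (intro image_eqI[of _ _ "inv_psi u"]) auto
qed (use that psi_gt_0 psi_less_iff in auto)

lemma DERIV_inv_psi: "(inv_psi has_real_derivative inverse (\<psi>' (inv_psi u))) (at u)" if u: "u > 0" for u
\<comment> \<open>The last two arguments only bracket \<open>u\<close> inside the half-line, where
  \<open>\<psi>\<close> undoes \<open>inv_psi\<close>.\<close>
proof (rule DERIV_inverse_function[of \<psi> _ _ _ "u / 2" "u + 1"])
  show "(\<psi> has_real_derivative \<psi>' (inv_psi u)) (at (inv_psi u))" using u by (simp add: DERIV_psi)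
  show "\<psi>' (inv_psi u) \<noteq> 0" using psi_pos[of "inv_psi u"] inv_psi_gt_0[OF u] by simp
  show "isCont inv_psi u"
  proof -
    let ?x = "inv_psi u"
    have "isCont inv_psi (\<psi> ?x)"
    proof (rule isCont_inverse_function2[of "?x / 2" ?x "?x + 1"])
      show "inv_psi (\<psi> z) = z" if "?x / 2 \<le> z" for z
        using that inv_psi_gt_0[OF u] by (intro inv_psi_psi) simp
      show "isCont \<psi> z" if "?x / 2 \<le> z" for z
        using that inv_psi_gt_0[OF u] by (intro DERIV_isCont[OF DERIV_psi]) simp
    qed (use inv_psi_gt_0[OF u] in auto)
    then show ?thesis using u by simp
  qed
qed (use u in auto)

lemma inv_psi_at_top: "filterlim inv_psi at_top at_top"
  unfolding filterlim_at_top_gt[where c = 0]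
proof (intro allI impI)
  fix Z :: real assume Z: "Z > 0"
  show "eventually (\<lambda>u. Z \<le> inv_psi u) at_top"
    using eventually_gt_at_top[of "\<psi> Z"]
  proof eventually_elim
    case (elim u)
    then show ?case using inv_psi_less_iff[of "\<psi> Z" u] psi_gt_0[OF Z] Z by simp
  qed
qed

lemma inv_psi_at_right_0: "filterlim inv_psi (at_right 0) (at_right 0)"
  unfolding filterlim_at
proof
  show "eventually (\<lambda>u. inv_psi u \<in> {0<..} \<and> inv_psi u \<noteq> 0) (at_right 0)"
    using eventually_at_right_less[of 0] by eventually_elim (metis greaterThan_iff inv_psi_gt_0 less_irrefl)
  show "(inv_psi \<longlongrightarrow> 0) (at_right 0)"
  proof (rule order_tendstoI)
    fix a :: real assume "a < 0"
    then show "eventually (\<lambda>u. a < inv_psi u) (at_right 0)"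
      using eventually_at_right_less[of 0] inv_psi_gt_0 by (metis (mono_tags, lifting) eventually_mono less_trans)
  next
    fix a :: real assume a: "a > 0"
    have "eventually (\<lambda>u. u \<in> {0<..<\<psi> a}) (at_right 0)"
      by (rule eventually_at_rightI[OF _ psi_gt_0[OF a]])
    then show "eventually (\<lambda>u. inv_psi u < a) (at_right 0)"
    proof eventually_elim
      case (elim u)
      then show ?case using inv_psi_less_iff[of u "\<psi> a"] psi_gt_0[OF a] a by simp
    qed
  qed
qed

text \<open>The substitution \<open>u = \<psi> x\<close>; positivity of \<open>\<psi>'\<close>
  identifies the Jacobian with the factor \<open>deriv \<psi> x\<close> of the weighted integrands.
  It serves the Mellin integrals on the half-line and the fractional integrals on
  \<open>{0<..<x}\<close> alike.\<close>

lemma change_of_variables_psi: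
  fixes G :: "real \<Rightarrow> complex"
  assumes S: "S \<in> sets lebesgue" "S \<subseteq> {0<..}"
    and g: "\<And>x. x \<in> S \<Longrightarrow> g x = G (\<psi> x) * of_real (deriv \<psi> x)"
  shows "g absolutely_integrable_on S \<longleftrightarrow> G absolutely_integrable_on \<psi> ` S"
    and "g absolutely_integrable_on S \<Longrightarrow> (LINT x:S|lebesgue. g x) = integral (\<psi> ` S) G"
proof -
  have eq: "g x = \<bar>\<psi>' x\<bar> *\<^sub>R G (\<psi> x)" if "x \<in> S" for x
    using g[OF that] deriv_psi[of x] psi_pos[of x] S(2) that by (auto simp: scaleR_conv_of_real mult.commute)
  \<comment> \<open>As \<open>b\<close> is arbitrary, this one equivalence transfers integrability
    and equates the integrals.\<close>
  have 1: "(\<lambda>x. \<bar>\<psi>' x\<bar> *\<^sub>R G (\<psi> x)) absolutely_integrable_on S \<and> integral S (\<lambda>x. \<bar>\<psi>' x\<bar> *\<^sub>R G (\<psi> x)) = b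
      \<longleftrightarrow> G absolutely_integrable_on \<psi> ` S \<and> integral (\<psi> ` S) G = b" for b
    using S by (intro has_absolute_integral_change_of_variables_real inj_on_subset[OF inj_on_psi])
      (auto intro: has_field_derivative_at_within DERIV_psi)
  have 2: "g absolutely_integrable_on S \<longleftrightarrow> (\<lambda>x. \<bar>\<psi>' x\<bar> *\<^sub>R G (\<psi> x)) absolutely_integrable_on S"
    by (rule set_integrable_cong) (auto simp: eq)
  have 3: "integral S g = integral S (\<lambda>x. \<bar>\<psi>' x\<bar> *\<^sub>R G (\<psi> x))"
    by (rule integral_cong) (auto simp: eq)
  show "g absolutely_integrable_on S \<longleftrightarrow> G absolutely_integrable_on \<psi> ` S"
    unfolding 2 using 1 by blast
  assume a: "g absolutely_integrable_on S"
  then have "integral S g = integral (\<psi> ` S) G" unfolding 2 3 using 1 by blast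
  then show "(LINT x:S|lebesgue. g x) = integral (\<psi> ` S) G"
    using set_lebesgue_integral_eq_integral(2)[OF a] by simp
qed

text \<open>In the variable \<open>u\<close> the weighted transform of \<open>g\<close> is the
  classical Mellin transform of \<open>\<omega>\<close> times \<open>g\<close>.\<close>

lemma mellin_scale:
  shows "mellin_abs_convergent \<psi> \<omega> g p \<longleftrightarrow>
      (\<lambda>u. of_real u powr (p - 1) * (\<omega> (inv_psi u) * g (inv_psi u))) absolutely_integrable_on {0<..}"
    and "mellin_abs_convergent \<psi> \<omega> g p \<Longrightarrow> mellin \<psi> \<omega> g p =
      integral {0<..} (\<lambda>u. of_real u powr (p - 1) * (\<omega> (inv_psi u) * g (inv_psi u)))"
proof -
  let ?G = "\<lambda>u. of_real u powr (p - 1) * (\<omega> (inv_psi u) * g (inv_psi u))"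
  have eq: "mellin_integrand \<psi> \<omega> g p x = ?G (\<psi> x) * of_real (deriv \<psi> x)" if "x \<in> {0<..}" for x
    using that by (simp add: mellin_integrand_def)
  show "mellin_abs_convergent \<psi> \<omega> g p \<longleftrightarrow> ?G absolutely_integrable_on {0<..}"
    unfolding mellin_abs_convergent_def
    using change_of_variables_psi(1)[of "{0<..}", OF _ subset_refl eq] by (simp add: psi_image)
  show "mellin \<psi> \<omega> g p = integral {0<..} ?G" if "mellin_abs_convergent \<psi> \<omega> g p"
    using change_of_variables_psi(2)[of "{0<..}", OF _ subset_refl eq] that
    unfolding mellin_abs_convergent_def mellin_def by (simp add: psi_image)
qed

text \<open>Multiplication by \<open>\<omega>\<close> cancels the prefactor of the weighted integral
  and leaves the classical Riemann-Liouville integral of \<open>\<omega>\<close> times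
  \<open>f\<close> in the variable \<open>u\<close>.\<close>

lemma RL_integral_scale:
  assumes "RL_integral_exists \<psi> \<omega> \<beta> f" and u: "u > 0" and nz: "\<omega> (inv_psi u) \<noteq> 0"
  shows "(\<lambda>s. of_real (u - s) powr (\<beta> - 1) * (\<omega> (inv_psi s) * f (inv_psi s))) absolutely_integrable_on {0<..<u}"
    and "\<omega> (inv_psi u) * RL_integral \<psi> \<omega> \<beta> f (inv_psi u) = 1 / Gamma \<beta> *
      integral {0<..<u} (\<lambda>s. of_real (u - s) powr (\<beta> - 1) * (\<omega> (inv_psi s) * f (inv_psi s)))"
proof -
  let ?x = "inv_psi u"
  let ?G = "\<lambda>s. of_real (u - s) powr (\<beta> - 1) * (\<omega> (inv_psi s) * f (inv_psi s))"
  have x: "?x > 0" using u by simp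
  have img: "\<psi> ` {0<..<?x} = {0<..<u}" using psi_image_Ioo[OF x] u by simp
  have eq: "RL_integrand \<psi> \<omega> \<beta> f ?x t = ?G (\<psi> t) * of_real (deriv \<psi> t)" if "t \<in> {0<..<?x}" for t
    using that u by (simp add: RL_integrand_def)
  have ai: "RL_integrand \<psi> \<omega> \<beta> f ?x absolutely_integrable_on {0<..<?x}"
    using assms(1) x by (simp add: RL_integral_exists_def)
  have sub: "{0<..<?x} \<subseteq> {0<..}" and S: "{0<..<?x} \<in> sets lebesgue" by auto
  show "?G absolutely_integrable_on {0<..<u}"
    using change_of_variables_psi(1)[OF S sub eq] ai unfolding img by blast
  have "(LINT t:{0<..<?x}|lebesgue. RL_integrand \<psi> \<omega> \<beta> f ?x t) = integral {0<..<u} ?G"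
    using change_of_variables_psi(2)[OF S sub eq ai] unfolding img .
  then show "\<omega> ?x * RL_integral \<psi> \<omega> \<beta> f ?x = 1 / Gamma \<beta> * integral {0<..<u} ?G"
    using nz by (simp add: RL_integral_def)
qed

text \<open>Conjugated by \<open>\<omega>\<close> and \<open>\<psi>\<close>, the weighted derivative
  is plain differentiation in \<open>u\<close>: the chain rule contributes the factor
  \<open>inverse (\<psi>' x)\<close> at \<open>x = inv_psi u\<close>.\<close>

lemma weighted_deriv_scale:
  assumes "(\<lambda>t. \<omega> t * g t) differentiable (at (inv_psi u))" and u: "u > 0" and nz: "\<omega> (inv_psi u) \<noteq> 0"
  shows "((\<lambda>u. \<omega> (inv_psi u) * g (inv_psi u)) has_vector_derivative
      \<omega> (inv_psi u) * weighted_deriv \<psi> \<omega> g (inv_psi u)) (at u)"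
proof -
  let ?x = "inv_psi u" and ?y = "\<lambda>t. \<omega> t * g t"
  have x: "?x > 0" using u by simp
  have "(inv_psi has_vector_derivative inverse (\<psi>' ?x)) (at u)"
    using DERIV_inv_psi[OF u] by (simp add: has_real_derivative_iff_has_vector_derivative)
  moreover have "(?y has_vector_derivative vector_derivative ?y (at ?x)) (at ?x)"
    using assms(1) by (simp add: vector_derivative_works)
  ultimately have "((?y \<circ> inv_psi) has_vector_derivative inverse (\<psi>' ?x) *\<^sub>R vector_derivative ?y (at ?x)) (at u)"
    by (rule vector_diff_chain_at)
  also have "inverse (\<psi>' ?x) *\<^sub>R vector_derivative ?y (at ?x) = \<omega> ?x * weighted_deriv \<psi> \<omega> g ?x"
    using nz by (simp add: weighted_deriv_def deriv_psi[OF x] scaleR_conv_of_real divide_inverse)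
  finally show ?thesis by (simp add: o_def)
qed

end

text \<open>For a continuous function an essential bound holds everywhere, since the set where it
  fails is open and negligible, hence empty.\<close>

lemma Linfty_pos_bounded:
  assumes "\<omega> \<in> Linfty_pos" and cont: "continuous_on {0<..} \<omega>"
  obtains C where "C > 0" "\<And>x. x > 0 \<Longrightarrow> norm (\<omega> x) \<le> C"
proof -
  from assms(1) obtain C where C: "AE x in lebesgue_on {0<..}. cmod (\<omega> x) \<le> C"
    by (auto simp: Linfty_pos_def)
  let ?U = "{x \<in> {0<..}. norm (\<omega> x) > C}"
  have "open ?U"
  proof -
    have "?U = {0<..} \<inter> (\<lambda>x. norm (\<omega> x)) -` {C<..}" by auto
    then show ?thesis
      using continuous_open_preimage[of "{0<..}" "\<lambda>x. norm (\<omega> x)" "{C<..}"] cont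
      by (simp add: continuous_on_norm)
  qed
  moreover have "negligible ?U"
  proof -
    have "AE x in lebesgue. x \<in> {0<..} \<longrightarrow> cmod (\<omega> x) \<le> C"
      using C by (simp add: AE_restrict_space_iff)
    then have "AE x in lebesgue. x \<notin> ?U" by eventually_elim auto
    then show ?thesis
      using \<open>open ?U\<close> by (subst negligible_iff_null_sets, subst (asm) AE_iff_null_sets[symmetric]) auto
  qed
  ultimately have "?U = {}" using open_not_negligible by blast
  then have "norm (\<omega> x) \<le> C" if "x > 0" for x using that not_le by blast
  then show ?thesis using that[of "max C 1"] by (simp add: le_max_iff_disj)
qed

section \<open>Reduction of the weighted formula to the classical one\<close>

theorem mainTheorem5:
  fixes \<psi> \<psi>' :: "real \<Rightarrow> real" and \<omega> f :: "real \<Rightarrow> complex" and \<alpha> p :: complex and n :: nat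
  assumes psi_deriv: "\<And>x. x \<ge> 0 \<Longrightarrow> (\<psi> has_real_derivative \<psi>' x) (at x within {0..})"
    and psi_C1: "continuous_on {0..} \<psi>'"
    and psi_pos: "\<And>x. x \<ge> 0 \<Longrightarrow> \<psi>' x > 0"
    and psi_0: "\<psi> 0 = 0"
    and psi_top: "filterlim \<psi> at_top at_top"
    and omega_bdd: "\<omega> \<in> Linfty_pos"
    and omega_nz: "\<And>x. x > 0 \<Longrightarrow> \<omega> x \<noteq> 0"
    and omega_diff: "\<And>x. x > 0 \<Longrightarrow> \<omega> differentiable (at x)"
    and alpha: "Re \<alpha> > 0"
    and n: "n = nat \<lfloor>Re \<alpha>\<rfloor> + 1"
    and p: "Re p < 1 + Re \<alpha>"
    and f_L1: "(\<lambda>x. of_real (\<psi> x) powr (p - \<alpha> - 1) * f x) \<in> L1_weighted \<psi> \<omega>"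
    and deriv_ex: "RL_derivative_exists \<psi> \<omega> \<alpha> f"
    and deriv_conv: "mellin_abs_convergent \<psi> \<omega> (RL_derivative \<psi> \<omega> \<alpha> f) p"
    and lim_0: "\<And>k. k < n \<Longrightarrow>
      ((\<lambda>x. of_real (\<psi> x) powr (p - of_nat k - 1) * RL_integral \<psi> \<omega> (of_nat n - \<alpha>) f x) \<longlongrightarrow> 0)
        (at_right 0)"
    and lim_top: "\<And>k. k < n \<Longrightarrow>
      ((\<lambda>x. of_real (\<psi> x) powr (p - of_nat k - 1) * RL_integral \<psi> \<omega> (of_nat n - \<alpha>) f x) \<longlongrightarrow> 0)
        at_top"
  shows "mellin \<psi> \<omega> (RL_derivative \<psi> \<omega> \<alpha> f) p =
    Gamma (1 - p + \<alpha>) / Gamma (1 - p) * mellin \<psi> \<omega> f (p - \<alpha>)"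
proof -
  interpret half_line_scale \<psi> \<psi>'
    by unfold_locales (fact psi_deriv psi_C1 psi_pos psi_0 psi_top)+
  define h where "h = RL_integral \<psi> \<omega> (of_nat n - \<alpha>) f"
  define F where "F s = \<omega> (inv_psi s) * f (inv_psi s)" for s
  define z where "z k u = \<omega> (inv_psi u) * (weighted_deriv \<psi> \<omega> ^^ k) h (inv_psi u)" for k u
  have order: "RL_order \<alpha> = n" by (simp add: RL_order_def n)
  have RL: "RL_derivative \<psi> \<omega> \<alpha> f = (weighted_deriv \<psi> \<omega> ^^ n) h"
    by (simp add: RL_derivative_def order h_def)
  have n0: "n > 0" and alpha_n: "Re \<alpha> < real n" using n alpha by (simp_all, linarith)
  have cont: "continuous_on {0<..} \<omega>"
    using omega_diff by (auto intro!: continuous_at_imp_continuous_on differentiable_imp_continuous_within)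
  \<comment> \<open>The limit hypotheses concern \<open>h\<close>, whereas \<open>z 0\<close> is
    \<open>\<omega>\<close> times \<open>h\<close>; the pointwise bound on \<open>\<omega>\<close>
    carries the decay over.\<close>
  obtain C where C: "C > 0" "\<And>x. x > 0 \<Longrightarrow> norm (\<omega> x) \<le> C"
    using Linfty_pos_bounded[OF omega_bdd cont] by blast
  have ex: "RL_integral_exists \<psi> \<omega> (of_nat n - \<alpha>) f"
    and diff: "\<And>k x. k < n \<Longrightarrow> x > 0 \<Longrightarrow> (\<lambda>t. \<omega> t * (weighted_deriv \<psi> \<omega> ^^ k) h t) differentiable (at x)"
    using deriv_ex by (auto simp: RL_derivative_exists_def order h_def Let_def)
  \<comment> \<open>Membership in \<open>L1_weighted\<close> bounds the norm of the integrand; the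
    measurability of the complex integrand is assembled from its factors, with
    \<open>deriv \<psi>\<close> handled through the continuous \<open>\<psi>'\<close>.\<close>
  have "mellin_abs_convergent \<psi> \<omega> f (p - \<alpha>)"
  proof -
    let ?g = "\<lambda>x. of_real (\<psi> x) powr (p - \<alpha> - 1) * f x"
    let ?M = "lebesgue_on {0<..} :: real measure"
    have L: "?g \<in> borel_measurable ?M" "integrable ?M (\<lambda>x. cmod (\<omega> x * ?g x) * deriv \<psi> x)"
      using f_L1 by (auto simp: L1_weighted_def)
    have om: "\<omega> \<in> borel_measurable ?M" using omega_bdd by (simp add: Linfty_pos_def)
    have "\<psi>' \<in> borel_measurable ?M"
      by (intro continuous_imp_measurable_on_sets_lebesgue continuous_on_subset[OF psi_C1]) auto
    then have d: "deriv \<psi> \<in> borel_measurable ?M"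
      by (rule measurable_cong[THEN iffD1, rotated]) (simp add: deriv_psi)
    have "integrable ?M (\<lambda>x. \<omega> x * ?g x * of_real (deriv \<psi> x))"
    proof (rule Bochner_Integration.integrable_bound[OF L(2)])
      show "(\<lambda>x. \<omega> x * ?g x * of_real (deriv \<psi> x)) \<in> borel_measurable ?M"
        using L(1) om d by measurable
    qed (auto intro!: AE_I2 simp: norm_mult)
    also have "(\<lambda>x. \<omega> x * ?g x * of_real (deriv \<psi> x)) = mellin_integrand \<psi> \<omega> f (p - \<alpha>)"
      by (auto simp: mellin_integrand_def fun_eq_iff)
    finally show ?thesis
      unfolding mellin_abs_convergent_def by (simp add: integrable_lebesgue_on_eq)
  qed
  note f_scale = mellin_scale(1)[THEN iffD1, OF this] mellin_scale(2)[OF this]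
  note D_scale = mellin_scale(1)[THEN iffD1, OF deriv_conv] mellin_scale(2)[OF deriv_conv]
  \<comment> \<open>For \<open>k = n - 1\<close> the exponent \<open>p - k - 1\<close> equals
    \<open>p - n\<close>, the one at which the interpolation needs the decay of
    \<open>z 0\<close>.\<close>
  have lim: "((\<lambda>u. u powr (Re p - real n) * norm (z 0 u)) \<longlongrightarrow> 0) F'"
    if l: "((\<lambda>x. of_real (\<psi> x) powr (p - of_nat (n - 1) - 1) * h x) \<longlongrightarrow> 0) F'"
      and filt: "filterlim inv_psi F' F'" and pos: "eventually (\<lambda>u. u > 0) F'" for F'
  proof -
    have "((\<lambda>u. C * norm (of_real (\<psi> (inv_psi u)) powr (p - of_nat (n - 1) - 1) * h (inv_psi u))) \<longlongrightarrow> 0) F'"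
      by (intro tendsto_mult_right_zero tendsto_norm_zero filterlim_compose[OF l filt])
    then show ?thesis
    proof (rule Lim_null_comparison[rotated])
      show "eventually (\<lambda>u. norm (u powr (Re p - real n) * norm (z 0 u)) \<le>
          C * norm (of_real (\<psi> (inv_psi u)) powr (p - of_nat (n - 1) - 1) * h (inv_psi u))) F'"
        using pos
      proof eventually_elim
        case (elim u)
        have e: "Re (p - of_nat (n - 1) - 1) = Re p - real n" using n0 by (simp add: of_nat_diff)
        have "norm (of_real (\<psi> (inv_psi u)) powr (p - of_nat (n - 1) - 1) * h (inv_psi u)) =
            u powr (Re p - real n) * norm (h (inv_psi u))"
          unfolding norm_mult psi_inv_psi[OF elim] norm_of_real_powr[OF elim] e ..
        moreover have "norm (z 0 u) \<le> C * norm (h (inv_psi u))"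
          using C(2)[OF inv_psi_gt_0[OF elim]] by (simp add: z_def norm_mult mult_right_mono)
        then have "u powr (Re p - real n) * norm (z 0 u) \<le> u powr (Re p - real n) * (C * norm (h (inv_psi u)))"
          by (intro mult_left_mono) auto
        ultimately show ?case by (simp add: mult.left_commute)
      qed
    qed
  qed
  have "integral {0<..} (\<lambda>u. of_real u powr (p - 1) * z n u) =
      Gamma (1 - p + \<alpha>) / Gamma (1 - p) * integral {0<..} (\<lambda>s. of_real s powr (p - \<alpha> - 1) * F s)"
  proof (rule Mellin_fractional_derivative[OF n0 alpha_n p])
    show "(\<lambda>s. of_real s powr (p - \<alpha> - 1) * F s) absolutely_integrable_on {0<..}"
      using f_scale(1) by (simp add: F_def)
    show "(\<lambda>u. of_real u powr (p - 1) * z n u) absolutely_integrable_on {0<..}"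
      using D_scale(1) by (simp add: z_def RL)
    show "((\<lambda>u. u powr (Re p - real n) * norm (z 0 u)) \<longlongrightarrow> 0) (at_right 0)"
      by (rule lim[OF _ inv_psi_at_right_0 eventually_at_right_less]) (use lim_0[of "n - 1"] n0 in \<open>simp add: h_def\<close>)
    show "((\<lambda>u. u powr (Re p - real n) * norm (z 0 u)) \<longlongrightarrow> 0) at_top"
      by (rule lim[OF _ inv_psi_at_top eventually_gt_at_top]) (use lim_top[of "n - 1"] n0 in \<open>simp add: h_def\<close>)
    fix u :: real assume u: "u > 0"
    have nz: "\<omega> (inv_psi u) \<noteq> 0" using omega_nz[of "inv_psi u"] u by simp
    show "(\<lambda>s. of_real (u - s) powr (of_nat n - \<alpha> - 1) * F s) absolutely_integrable_on {0<..<u}"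
      unfolding F_def by (rule RL_integral_scale(1)[OF ex u nz])
    show "z 0 u = 1 / Gamma (of_nat n - \<alpha>) * integral {0<..<u} (\<lambda>s. of_real (u - s) powr (of_nat n - \<alpha> - 1) * F s)"
      unfolding F_def z_def funpow_0 h_def by (rule RL_integral_scale(2)[OF ex u nz])
    show "(z j has_vector_derivative z (Suc j) u) (at u)" if "j < n" for j
      using weighted_deriv_scale[OF diff[OF that inv_psi_gt_0[OF u]] u nz] unfolding z_def[abs_def] by simp
  qed
  then show ?thesis
    unfolding D_scale(2) f_scale(2) by (simp add: z_def F_def RL)
qed

end
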